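(* Suppose that $\mathcal{X}$ is a Polish space with its Borel $\sigma$-algebra. Then for any order $\alpha\in(0,\infty]$, $D_\alpha(P\|Q)$ is a lower semi-continuous function of the pair $(P,Q)$ of probability distributions on $\mathcal{X}$ in the weak topology.
   Context: The weak topology is the (metrizable) topology in which $P_n\to P$ means $\int f\,dP_n\to\int f\,dP$ for every bounded continuous $f\colon\mathcal{X}\to\mathbb{R}$; pairs $(P,Q)$ carry the product topology. Rényi divergence: let $P,Q$ have densities $p,q$ with respect to a dominating $\sigma$-finite measure $\mu$ (whose choice is immaterial). For $\alpha\in(0,1)\cup(1,\infty)$, $D_\alpha(P\|Q)=\frac{1}{\alpha-1}\ln\int p^\alpha q^{1-\alpha}\,d\mu\in[0,\infty]$, where for $\alpha>1$ one reads $p^\alpha q^{1-\alpha}$ as $p^\alpha/q^{\alpha-1}$ with the conventions $0/0=0$ and $x/0=\infty$ for $x>0$. Further $D_1(P\|Q)=\lim_{\alpha\uparrow1}D_\alpha(P\|Q)$ and $D_\infty(P\|Q)=\lim_{\alpha\uparrow\infty}D_\alpha(P\|Q)$ (these limits always exist in $[0,\infty]$). *)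

theory Defs
  imports "HOL-Probability.Probability"
begin

section \<open>The weak topology on Borel probability measures\<close>

definition borel_prob_measures :: "'a::topological_space measure set" where
  "borel_prob_measures = {P. sets P = sets borel \<and> prob_space P}"

text \<open>
  The coarsest topology for which \<open>P \<mapsto> \<integral>f dP\<close> is continuous for every bounded
  continuous \<open>f\<close>. The lemma \<open>limitin_weak_topology\<close> below shows that its convergence
  (along any filter) is convergence of all these integrals.
\<close>

definition weak_topology :: "'a::topological_space measure topology" where
  "weak_topology = topology_generated_by
     {{P \<in> borel_prob_measures. (\<integral>x. f x \<partial>P) \<in> U} | (f :: 'a \<Rightarrow> real) U.
        continuous_on UNIV f \<and> bounded (range f) \<and> open U}"

lemma topspace_weak_topology [simp]: "topspace weak_topology = borel_prob_measures"
proof -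
  have "\<exists>(f :: 'a \<Rightarrow> real) U. borel_prob_measures = {P \<in> borel_prob_measures. (\<integral>x. f x \<partial>P) \<in> U}
      \<and> continuous_on UNIV f \<and> bounded (range f) \<and> open U"
    by (intro exI[of _ "\<lambda>_. 0"] exI[of _ UNIV]) auto
  then show ?thesis
    unfolding weak_topology_def topology_generated_by_topspace by blast
qed

lemma limitin_weak_topology:
  fixes P :: "'a::topological_space measure"
  shows "limitin weak_topology Pn P F \<longleftrightarrow>
    P \<in> borel_prob_measures \<and> (\<forall>\<^sub>F n in F. Pn n \<in> borel_prob_measures) \<and>
    (\<forall>f :: 'a \<Rightarrow> real. continuous_on UNIV f \<longrightarrow> bounded (range f) \<longrightarrow>
        ((\<lambda>n. \<integral>x. f x \<partial>Pn n) \<longlongrightarrow> (\<integral>x. f x \<partial>P)) F)"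
    (is "?L \<longleftrightarrow> ?R")
proof
  assume L: ?L
  have P: "P \<in> borel_prob_measures"
    using L by (auto simp: limitin_def)
  have "\<forall>\<^sub>F n in F. Pn n \<in> borel_prob_measures"
    using L openin_topspace[of "weak_topology :: 'a measure topology"]
    unfolding limitin_def topspace_weak_topology by blast
  moreover have "((\<lambda>n. \<integral>x. f x \<partial>Pn n) \<longlongrightarrow> (\<integral>x. f x \<partial>P)) F"
    if f: "continuous_on UNIV f" "bounded (range f)" for f :: "'a \<Rightarrow> real"
  proof (rule topological_tendstoI)
    fix U :: "real set" assume U: "open U" "(\<integral>x. f x \<partial>P) \<in> U"
    have "openin weak_topology {P \<in> borel_prob_measures. (\<integral>x. f x \<partial>P) \<in> U}"
      unfolding weak_topology_def using f U
      by (intro topology_generated_by_Basis) blast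
    then have "\<forall>\<^sub>F n in F. Pn n \<in> {P \<in> borel_prob_measures. (\<integral>x. f x \<partial>P) \<in> U}"
      using L P U by (auto simp: limitin_def)
    then show "\<forall>\<^sub>F n in F. (\<integral>x. f x \<partial>Pn n) \<in> U"
      by eventually_elim simp
  qed
  ultimately show ?R using P by blast
next
  assume R: ?R
  have "P \<in> W \<longrightarrow> (\<forall>\<^sub>F n in F. Pn n \<in> W)" if "openin weak_topology W" for W
    using that unfolding weak_topology_def openin_topology_generated_by_iff
  proof (induction W rule: generate_topology_on.induct)
    case Empty
    then show ?case by simp
  next
    case (Int a b)
    then show ?case by (auto intro: eventually_conj)
  next
    case (UN K)
    show ?case
    proof
      assume "P \<in> \<Union>K"
      then obtain k where k: "k \<in> K" "P \<in> k" by blast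
      then have "\<forall>\<^sub>F n in F. Pn n \<in> k" using UN.IH by blast
      then show "\<forall>\<^sub>F n in F. Pn n \<in> \<Union>K"
        by eventually_elim (use k in blast)
    qed
  next
    case (Basis s)
    then obtain f :: "'a \<Rightarrow> real" and U where
      s: "s = {P \<in> borel_prob_measures. (\<integral>x. f x \<partial>P) \<in> U}"
        and f: "continuous_on UNIV f" "bounded (range f)" and U: "open U"
      by blast
    show ?case
    proof
      assume "P \<in> s"
      then have "\<forall>\<^sub>F n in F. (\<integral>x. f x \<partial>Pn n) \<in> U"
        using R f U s by (auto dest: topological_tendstoD)
      then show "\<forall>\<^sub>F n in F. Pn n \<in> s"
        using R unfolding s by (auto elim: eventually_elim2)
    qed
  qed
  then show ?L using R by (auto simp: limitin_def)
qed

definition lower_semicontinuous_map :: "'a topology \<Rightarrow> ('a \<Rightarrow> 'b::linorder) \<Rightarrow> bool" where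
  "lower_semicontinuous_map X f \<longleftrightarrow> (\<forall>c. openin X {x \<in> topspace X. c < f x})"


section \<open>Renyi divergence\<close>

definition sum_measure :: "'a measure \<Rightarrow> 'a measure \<Rightarrow> 'a measure" where
  "sum_measure P Q = measure_of (space P) (sets P) (\<lambda>A. emeasure P A + emeasure Q A)"

lemma sets_sum_measure [simp, measurable_cong]: "sets (sum_measure P Q) = sets P"
  and space_sum_measure [simp]: "space (sum_measure P Q) = space P"
  by (simp_all add: sum_measure_def)

lemma emeasure_sum_measure:
  assumes "sets Q = sets P" "A \<in> sets P"
  shows "emeasure (sum_measure P Q) A = emeasure P A + emeasure Q A"
proof (rule emeasure_measure_of[OF sum_measure_def])
  show "sets P \<subseteq> Pow (space P)" by (rule sets.space_closed)
  show "A \<in> sets (sum_measure P Q)" using assms by simp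
  show "positive (sets (sum_measure P Q)) (\<lambda>A. emeasure P A + emeasure Q A)"
    by (simp add: positive_def)
  show "countably_additive (sets (sum_measure P Q)) (\<lambda>A. emeasure P A + emeasure Q A)"
    using assms(1)
    by (auto simp: countably_additive_def suminf_add[symmetric] suminf_emeasure)
qed

text \<open>
  The integrand \<open>p\<^sup>\<alpha> q\<^sup>1\<^sup>-\<^sup>\<alpha>\<close>. Division on \<^typ>\<open>ennreal\<close> already satisfies
  \<open>0 / 0 = 0\<close> and \<open>x / 0 = \<infinity>\<close> for \<open>x > 0\<close>, as required when \<open>\<alpha> > 1\<close>.
\<close>

definition renyi_integrand :: "real \<Rightarrow> real \<Rightarrow> real \<Rightarrow> ennreal" where
  "renyi_integrand \<alpha> p q =
     (if \<alpha> < 1 then ennreal (p powr \<alpha> * q powr (1 - \<alpha>))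
      else ennreal (p powr \<alpha>) / ennreal (q powr (\<alpha> - 1)))"

text \<open>
  The dominating measure is taken to be \<open>P + Q\<close>; the lemma \<open>renyi_integral_eq\<close> below shows
  that any other choice of dominating measure and densities gives the same value.
\<close>

definition renyi_integral :: "real \<Rightarrow> 'a measure \<Rightarrow> 'a measure \<Rightarrow> ennreal" where
  "renyi_integral \<alpha> P Q =
     (let \<mu> = sum_measure P Q in
      \<integral>\<^sup>+x. renyi_integrand \<alpha> (enn2real (RN_deriv \<mu> P x)) (enn2real (RN_deriv \<mu> Q x)) \<partial>\<mu>)"

definition ln_ennreal :: "ennreal \<Rightarrow> ereal" where
  "ln_ennreal x =
     (if x = 0 then -\<infinity> else if x = \<infinity> then \<infinity> else ereal (ln (enn2real x)))"

definition renyi_divergence_simple :: "real \<Rightarrow> 'a measure \<Rightarrow> 'a measure \<Rightarrow> ereal" where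
  "renyi_divergence_simple \<alpha> P Q = ereal (1 / (\<alpha> - 1)) * ln_ennreal (renyi_integral \<alpha> P Q)"

definition renyi_divergence :: "ereal \<Rightarrow> 'a measure \<Rightarrow> 'a measure \<Rightarrow> ereal" where
  "renyi_divergence \<alpha> P Q =
     (if \<alpha> = 1 then Lim (at_left 1) (\<lambda>a. renyi_divergence_simple a P Q)
      else if \<alpha> = \<infinity> then Lim at_top (\<lambda>a. renyi_divergence_simple a P Q)
      else renyi_divergence_simple (real_of_ereal \<alpha>) P Q)"

lemma renyi_integrand_scale:
  assumes "0 < \<alpha>" "\<alpha> \<noteq> 1" "0 \<le> s" "0 \<le> p" "0 \<le> q"
  shows "ennreal s * renyi_integrand \<alpha> p q = renyi_integrand \<alpha> (s * p) (s * q)"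
proof (cases "s = 0")
  case True
  then show ?thesis by (simp add: renyi_integrand_def)
next
  case False
  with assms have s: "s > 0" by simp
  show ?thesis
  proof (cases "\<alpha> < 1")
    case True
    have "s powr \<alpha> * s powr (1 - \<alpha>) = s"
      using s by (simp flip: powr_add)
    then have "s * (p powr \<alpha> * q powr (1 - \<alpha>)) = (s * p) powr \<alpha> * (s * q) powr (1 - \<alpha>)"
      using assms by (simp add: powr_mult)
    then show ?thesis
      using True assms by (simp add: renyi_integrand_def ennreal_mult'[symmetric])
  next
    case False
    have eq: "s powr \<alpha> / s powr (\<alpha> - 1) = s"
      using s by (simp flip: powr_diff)
    consider "q = 0" "p = 0" | "q = 0" "p > 0" | "q > 0"
      using assms by linarith
    then show ?thesis
    proof cases
      case 3
      have "(s * p) powr \<alpha> / (s * q) powr (\<alpha> - 1) =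
          (s powr \<alpha> / s powr (\<alpha> - 1)) * (p powr \<alpha> / q powr (\<alpha> - 1))"
        using assms by (simp only: powr_mult times_divide_times_eq)
      then have "s * (p powr \<alpha> / q powr (\<alpha> - 1)) = (s * p) powr \<alpha> / (s * q) powr (\<alpha> - 1)"
        unfolding eq by (rule sym)
      then show ?thesis
        using False assms s 3
        by (simp add: renyi_integrand_def divide_ennreal ennreal_mult'[symmetric])
    qed (use False s in \<open>auto simp: renyi_integrand_def ennreal_divide_eq_top_iff ennreal_mult_eq_top_iff divide_ennreal_def ennreal_mult_top\<close>)
  qed
qed

lemma renyi_integral_eq:
  fixes p q :: "'a \<Rightarrow> real"
  assumes "0 < \<alpha>" "\<alpha> \<noteq> 1"
    and \<mu>: "sigma_finite_measure \<mu>"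
    and meas [measurable]: "p \<in> borel_measurable \<mu>" "q \<in> borel_measurable \<mu>"
    and nonneg: "\<And>x. 0 \<le> p x" "\<And>x. 0 \<le> q x"
    and dens: "density \<mu> p = P" "density \<mu> q = Q"
    and fin: "finite_measure P" "finite_measure Q"
  shows "renyi_integral \<alpha> P Q = (\<integral>\<^sup>+x. renyi_integrand \<alpha> (p x) (q x) \<partial>\<mu>)"
proof -
  define \<nu> where "\<nu> = sum_measure P Q"
  have setsP [simp, measurable_cong]: "sets P = sets \<mu>"
    and setsQ [simp, measurable_cong]: "sets Q = sets \<mu>"
    and sets\<nu> [simp, measurable_cong]: "sets \<nu> = sets \<mu>"
    using dens by (auto simp: \<nu>_def)
  have \<nu>: "\<nu> = density \<mu> (\<lambda>x. ennreal (p x + q x))"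
  proof (rule measure_eqI)
    fix A assume "A \<in> sets \<nu>"
    then have A: "A \<in> sets \<mu>" by simp
    have "emeasure \<nu> A = emeasure P A + emeasure Q A"
      unfolding \<nu>_def using A by (intro emeasure_sum_measure) simp_all
    also have "\<dots> = (\<integral>\<^sup>+x. ennreal (p x) * indicator A x \<partial>\<mu>) + (\<integral>\<^sup>+x. ennreal (q x) * indicator A x \<partial>\<mu>)"
      using A by (simp add: dens[symmetric] emeasure_density)
    also have "\<dots> = emeasure (density \<mu> (\<lambda>x. ennreal (p x + q x))) A"
      using A nonneg
      by (simp add: emeasure_density nn_integral_add[symmetric] distrib_right)
    finally show "emeasure \<nu> A = emeasure (density \<mu> (\<lambda>x. ennreal (p x + q x))) A" .
  qed simp
  have em\<nu>: "emeasure \<nu> A = emeasure P A + emeasure Q A" if "A \<in> sets \<mu>" for A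
    unfolding \<nu>_def using that by (intro emeasure_sum_measure) simp_all
  have fin\<nu>: "finite_measure \<nu>"
  proof
    have "space \<nu> = space P" "space Q = space P"
      using sets_eq_imp_space_eq[OF setsQ] sets_eq_imp_space_eq[OF setsP] by (simp_all add: \<nu>_def)
    then show "emeasure \<nu> (space \<nu>) \<noteq> \<infinity>"
      using fin[THEN finite_measure.emeasure_finite] em\<nu>[of "space P"] sets.top[of P]
      by (simp add: ennreal_add_eq_top)
  qed
  interpret \<nu>: finite_measure \<nu> by (rule fin\<nu>)
  have main: "AE x in \<mu>. (p x + q x) * enn2real (RN_deriv \<nu> R x) = r x"
    if R: "density \<mu> r = R" and r [measurable]: "r \<in> borel_measurable \<mu>"
      and r0: "\<And>x. 0 \<le> r x" and le: "\<And>A. A \<in> sets \<mu> \<Longrightarrow> emeasure R A \<le> emeasure \<nu> A"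
      and finR: "finite_measure R"
    for r :: "'a \<Rightarrow> real" and R
  proof -
    have setsR: "sets R = sets \<mu>" using R by auto
    have ac: "absolutely_continuous \<nu> R"
      unfolding absolutely_continuous_def
    proof
      fix A assume "A \<in> null_sets \<nu>"
      then show "A \<in> null_sets R"
        using le[of A] setsR by (auto simp: null_sets_def)
    qed
    let ?d = "\<lambda>x. enn2real (RN_deriv \<nu> R x)"
    have "AE x in \<nu>. RN_deriv \<nu> R x \<noteq> \<infinity>"
      using \<nu>.RN_deriv_finite[OF _ ac] finR setsR
      by (simp add: finite_measure.axioms(1))
    then have "density \<nu> (RN_deriv \<nu> R) = density \<nu> (\<lambda>x. ennreal (?d x))"
      by (intro density_cong) (auto simp: less_top)
    then have "R = density \<nu> (\<lambda>x. ennreal (?d x))"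
      using \<nu>.density_RN_deriv[OF ac] setsR by simp
    also have "\<dots> = density \<mu> (\<lambda>x. ennreal (p x + q x) * ennreal (?d x))"
      unfolding \<nu> by (subst density_density_eq) (auto simp flip: \<nu>)
    finally have "density \<mu> (\<lambda>x. ennreal (p x + q x) * ennreal (?d x)) = density \<mu> r"
      using R by simp
    then have "AE x in \<mu>. ennreal (p x + q x) * ennreal (?d x) = ennreal (r x)"
      by (subst (asm) sigma_finite_measure.density_unique_iff[OF \<mu>]) auto
    then show ?thesis
    proof eventually_elim
      case (elim x)
      have "ennreal ((p x + q x) * ?d x) = ennreal (r x)"
        unfolding elim[symmetric] by (rule ennreal_mult) (simp_all add: nonneg)
      then show ?case
        by (subst (asm) ennreal_inj) (simp_all add: nonneg r0)
    qed
  qed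
  have P: "AE x in \<mu>. (p x + q x) * enn2real (RN_deriv \<nu> P x) = p x"
    using em\<nu> by (intro main dens meas nonneg fin) simp
  have Q: "AE x in \<mu>. (p x + q x) * enn2real (RN_deriv \<nu> Q x) = q x"
    using em\<nu> by (intro main dens meas nonneg fin) simp
  have [measurable]: "(\<lambda>x. renyi_integrand \<alpha> (f x) (g x)) \<in> borel_measurable \<mu>"
    if [measurable]: "f \<in> borel_measurable \<mu>" "g \<in> borel_measurable \<mu>" for f g
    unfolding renyi_integrand_def by measurable
  have "renyi_integral \<alpha> P Q =
      (\<integral>\<^sup>+x. renyi_integrand \<alpha> (enn2real (RN_deriv \<nu> P x)) (enn2real (RN_deriv \<nu> Q x)) \<partial>\<nu>)"
    by (simp add: renyi_integral_def \<nu>_def Let_def)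
  also have "\<dots> = (\<integral>\<^sup>+x. ennreal (p x + q x) *
      renyi_integrand \<alpha> (enn2real (RN_deriv \<nu> P x)) (enn2real (RN_deriv \<nu> Q x)) \<partial>\<mu>)"
    by (subst \<nu>, subst nn_integral_density) (auto simp flip: \<nu>)
  also have "\<dots> = (\<integral>\<^sup>+x. renyi_integrand \<alpha> (p x) (q x) \<partial>\<mu>)"
  proof (rule nn_integral_cong_AE)
    show "AE x in \<mu>. ennreal (p x + q x) *
        renyi_integrand \<alpha> (enn2real (RN_deriv \<nu> P x)) (enn2real (RN_deriv \<nu> Q x)) =
        renyi_integrand \<alpha> (p x) (q x)"
      using P Q
    proof eventually_elim
      case (elim x)
      show ?case
        by (subst renyi_integrand_scale) (use elim nonneg assms(1,2) in simp_all)
    qed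
  qed
  finally show ?thesis .
qed

end

theory Submission
  imports Defs
begin

text \<open>
  For \<open>\<alpha> < 1\<close> Young's inequality gives \<open>p\<^sup>\<alpha> q\<^sup>1\<^sup>-\<^sup>\<alpha> \<le> \<alpha> u\<^sup>1\<^sup>-\<^sup>\<alpha> p + (1 - \<alpha>) u\<^sup>-\<^sup>\<alpha> q\<close> for all \<open>u > 0\<close>, with
  equality at \<open>u = q / p\<close>; for \<open>\<alpha> > 1\<close> it gives
  \<open>p\<^sup>\<alpha> q\<^sup>1\<^sup>-\<^sup>\<alpha> \<ge> \<alpha> u\<^sup>\<alpha>\<^sup>-\<^sup>1 p - (\<alpha> - 1) u\<^sup>\<alpha> q\<close> for all \<open>u \<ge> 0\<close>, with equality at \<open>u = p / q\<close>. Integrating,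
  the Renyi integral is an infimum (resp. supremum) of functionals
  \<open>\<integral>\<phi> \<circ> u dP + \<integral>\<psi> \<circ> u dQ\<close>. By regularity of Borel measures on a Polish space it is enough to
  let \<open>u\<close> range over bounded continuous functions, and then these functionals are weakly
  continuous. Since \<open>D\<^sub>\<alpha>\<close> is nondecreasing in \<open>\<alpha>\<close>, again by Young's inequality, the orders \<open>1\<close> and
  \<open>\<infinity>\<close> are suprema of the orders in \<open>(0, 1)\<close> and \<open>(1, \<infinity>)\<close>.
\<close>

section \<open>Approximation by continuous functions\<close>

text \<open>Regularity traps \<open>A\<close> between a compact \<open>K\<close> and an open
  \<open>U\<close> whose masses differ by less than \<open>e\<close>. A Urysohn function that is 1
  on \<open>K\<close> and 0 off \<open>U\<close> differs from the indicator only on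
  \<open>U - K\<close>, and there by at most 1.\<close>

lemma L1_approx_indicator:
  fixes M :: "'a::polish_space measure"
  assumes M: "sets M = sets borel" "finite_measure M" and A: "A \<in> sets M" and e: "0 < (e::real)"
  obtains g :: "'a \<Rightarrow> real" where "continuous_on UNIV g" "bounded (range g)"
    "(\<integral>x. \<bar>indicator A x - g x\<bar> \<partial>M) < e"
proof -
  interpret finite_measure M by fact
  have A': "A \<in> sets borel" using A M by simp
  have eA: "emeasure M A = (SUP K \<in> {K. K \<subseteq> A \<and> compact K}. emeasure M K)"
    "emeasure M A = (INF U \<in> {U. A \<subseteq> U \<and> open U}. emeasure M U)"
    using inner_regular[OF M(1) _ A'] outer_regular[OF M(1) _ A'] by auto
  obtain U where U: "A \<subseteq> U" "open U" "measure M U < measure M A + e/2"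
  proof -
    have "(INF U \<in> {U. A \<subseteq> U \<and> open U}. emeasure M U) < ennreal (measure M A + e/2)"
      unfolding eA(2)[symmetric] using e by (simp add: emeasure_eq_measure ennreal_less_iff)
    then obtain U where U: "A \<subseteq> U" "open U" "emeasure M U < ennreal (measure M A + e/2)"
      unfolding INF_less_iff by blast
    from U(3) have "measure M U < measure M A + e/2"
      by (simp add: emeasure_eq_measure ennreal_less_iff)
    with U show ?thesis using that by blast
  qed
  obtain K where K: "K \<subseteq> A" "compact K" "measure M A < measure M K + e/2"
  \<comment> \<open>A null set needs its own case because \<open>ennreal\<close> truncates negative
    reals to 0, so \<open>ennreal (measure M A - e/2) < emeasure M A\<close> fails there. The empty
    set serves as \<open>K\<close>.\<close>
  proof (cases "measure M A = 0")
    case True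
    then show ?thesis using that[of "{}"] e by auto
  next
    case False
    then have "0 < measure M A" by (simp add: zero_less_measure_iff)
    then have "ennreal (measure M A - e/2) < emeasure M A"
      using e by (simp add: emeasure_eq_measure ennreal_lessI)
    then obtain K where K: "K \<subseteq> A" "compact K" "ennreal (measure M A - e/2) < emeasure M K"
      unfolding less_SUP_iff eA(1) by blast
    from K(3) have "measure M A - e/2 < measure M K"
      by (cases "measure M A - e/2 \<ge> 0") (auto simp: emeasure_eq_measure ennreal_less_iff intro: less_le_trans[OF _ measure_nonneg])
    with K show ?thesis using that[of K] by auto
  qed
  have UM: "U \<in> sets M" and KM: "K \<in> sets M"
    using U K M by (auto simp: compact_imp_closed)
  have "normal_space (euclidean :: 'a topology)"
    by (intro metrizable_imp_normal_space metrizable_space_euclidean)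
  moreover have "closedin euclidean K" "closedin euclidean (- U)" "disjnt K (- U)"
    using U K by (auto simp: compact_imp_closed disjnt_def)
  ultimately obtain g :: "'a \<Rightarrow> real"
    where g: "continuous_map euclidean (top_of_set {0..1}) g" "g ` (- U) \<subseteq> {0}" "g ` K \<subseteq> {1}"
    using Urysohn_lemma[of euclidean "- U" K 0 1] by (auto simp: disjnt_sym)
  have cont: "continuous_on UNIV g" and g01: "\<And>x. 0 \<le> g x \<and> g x \<le> 1"
    using g(1) by (auto simp: continuous_map_in_subtopology image_subset_iff)
  have [measurable]: "g \<in> borel_measurable M"
    using cont M by (simp add: borel_measurable_continuous_onI cong: measurable_cong_sets)
  have int: "integrable M (indicator (U - K) :: 'a \<Rightarrow> real)"
    using UM KM by (simp add: sets.Diff emeasure_eq_measure)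
  have "(\<integral>x. \<bar>indicator A x - g x\<bar> \<partial>M) \<le> (\<integral>x. indicator (U - K) x \<partial>M)"
  proof (rule integral_mono)
    show "integrable M (\<lambda>x. \<bar>indicator A x - g x\<bar>)"
      using A by (intro integrable_const_bound[where B=1]) (auto simp: indicator_def g01)
    show "\<bar>indicator A x - g x\<bar> \<le> indicator (U - K) x" for x
      using g(2,3) g01[of x] U(1) K(1) by (force simp: indicator_def image_subset_iff split: if_splits)
  qed (rule int)
  also have "\<dots> = measure M U - measure M K"
    using UM KM K(1) U(1) by (simp add: finite_measure_Diff)
  also have "\<dots> < e" using U(3) K(3) by simp
  finally have "(\<integral>x. \<bar>indicator A x - g x\<bar> \<partial>M) < e" .
  moreover have "bounded (range g)"
    using g01 by (intro boundedI[where B=1]) auto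
  ultimately show ?thesis using that cont by blast
qed

text \<open>Induction over integrable functions: scaled indicators come from regularity, sums from
  the triangle inequality, and pointwise limits from dominated convergence followed by approximation
  of one member of the sequence.\<close>

lemma L1_approx_continuous:
  fixes M :: "'a::polish_space measure" and f :: "'a \<Rightarrow> real"
  assumes M: "sets M = sets borel" "finite_measure M" and f: "integrable M f" and e: "0 < e"
  shows "\<exists>g. continuous_on UNIV g \<and> bounded (range g) \<and> (\<integral>x. \<bar>f x - g x\<bar> \<partial>M) < e"
  using f e
proof (induction arbitrary: e rule: integrable_induct)
  interpret finite_measure M by fact
  have intg: "integrable M g" if g: "continuous_on UNIV g" "bounded (range g)" for g :: "'a \<Rightarrow> real"
  proof -
    obtain B where "\<And>x. \<bar>g x\<bar> \<le> B" using g(2) by (auto simp: bounded_iff)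
    moreover have "g \<in> borel_measurable M"
      using g M by (simp add: borel_measurable_continuous_onI cong: measurable_cong_sets)
    ultimately show ?thesis by (intro integrable_const_bound[where B=B]) auto
  qed
  {
    case (base A c)
    \<comment> \<open>Dividing by \<open>\<bar>c\<bar> + 1\<close> covers \<open>c = 0\<close> and
      keeps the final inequality strict, since
      \<open>\<bar>c\<bar> / (\<bar>c\<bar> + 1) < 1\<close>.\<close>
    obtain g :: "'a \<Rightarrow> real" where g: "continuous_on UNIV g" "bounded (range g)"
      "(\<integral>x. \<bar>indicator A x - g x\<bar> \<partial>M) < e / (\<bar>c\<bar> + 1)"
      by (rule L1_approx_indicator[OF M base(1), of "e / (\<bar>c\<bar> + 1)"]) (use base in auto)
    have "(\<integral>x. \<bar>indicator A x *\<^sub>R c - c * g x\<bar> \<partial>M) = \<bar>c\<bar> * (\<integral>x. \<bar>indicator A x - g x\<bar> \<partial>M)"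
      by (simp flip: integral_mult_right_zero abs_mult) (simp add: algebra_simps)
    also have "\<dots> \<le> \<bar>c\<bar> * (e / (\<bar>c\<bar> + 1))"
      using g(3) by (intro mult_left_mono) auto
    also have "\<dots> < e" using base(3) by (simp add: field_simps)
    finally have "(\<integral>x. \<bar>indicator A x *\<^sub>R c - c * g x\<bar> \<partial>M) < e" .
    moreover have "continuous_on UNIV (\<lambda>x. c * g x)" "bounded (range (\<lambda>x. c * g x))"
      using g bounded_scaling[of "range g" c] by (auto intro!: continuous_intros simp: image_image)
    ultimately show ?case by blast
  next
    case (add f h)
    obtain g k where gk: "continuous_on UNIV g" "bounded (range g)" "(\<integral>x. \<bar>f x - g x\<bar> \<partial>M) < e/2"
      "continuous_on UNIV k" "bounded (range k)" "(\<integral>x. \<bar>h x - k x\<bar> \<partial>M) < e/2"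
      using add.IH[of "e/2"] add.prems by auto
    note [simp] = intg[OF gk(1,2)] intg[OF gk(4,5)] add.hyps
    have "(\<integral>x. \<bar>f x + h x - (g x + k x)\<bar> \<partial>M) \<le> (\<integral>x. \<bar>f x - g x\<bar> + \<bar>h x - k x\<bar> \<partial>M)"
      by (intro integral_mono) auto
    also have "\<dots> = (\<integral>x. \<bar>f x - g x\<bar> \<partial>M) + (\<integral>x. \<bar>h x - k x\<bar> \<partial>M)"
      by (intro Bochner_Integration.integral_add) auto
    also have "\<dots> < e" using gk by simp
    finally show ?case
      using gk by (intro exI[of _ "\<lambda>x. g x + k x"]) (auto intro!: continuous_intros bounded_plus_comp)
  next
    case (lim f s)
    have "(\<lambda>i. \<integral>x. \<bar>f x - s i x\<bar> \<partial>M) \<longlonglongrightarrow> (\<integral>x. 0 \<partial>M)"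
    \<comment> \<open>The induction rule supplies a sequence with
      \<open>\<bar>s i x\<bar> \<le> 2 * \<bar>f x\<bar>\<close>; adding
      \<open>\<bar>f x\<bar>\<close> gives the factor 3.\<close>
    proof (rule integral_dominated_convergence[where w="\<lambda>x. 3 * \<bar>f x\<bar>"])
      show "AE x in M. (\<lambda>i. \<bar>f x - s i x\<bar>) \<longlonglongrightarrow> 0"
      proof (rule AE_I2)
        fix x assume "x \<in> space M"
        then have "(\<lambda>i. s i x) \<longlonglongrightarrow> f x" by (rule lim.hyps)
        from tendsto_diff[OF tendsto_const this, of "f x"] show "(\<lambda>i. \<bar>f x - s i x\<bar>) \<longlonglongrightarrow> 0"
          by (simp add: tendsto_rabs_zero_iff)
      qed
      show "AE x in M. norm \<bar>f x - s i x\<bar> \<le> 3 * \<bar>f x\<bar>" for i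
        using lim.hyps(3)[of _ i] by (intro AE_I2) fastforce
    qed (use lim.hyps in auto)
    then obtain i where i: "(\<integral>x. \<bar>f x - s i x\<bar> \<partial>M) < e/2"
      using order_tendstoD(2)[of _ _ _ "e/2"] lim.prems by (force simp: eventually_sequentially)
    obtain g where g: "continuous_on UNIV g" "bounded (range g)" "(\<integral>x. \<bar>s i x - g x\<bar> \<partial>M) < e/2"
      using lim.IH[of "e/2" i] lim.prems by auto
    note [simp] = intg[OF g(1,2)] lim.hyps(1,4)
    have "(\<integral>x. \<bar>f x - g x\<bar> \<partial>M) \<le> (\<integral>x. \<bar>f x - s i x\<bar> + \<bar>s i x - g x\<bar> \<partial>M)"
      by (intro integral_mono) auto
    also have "\<dots> = (\<integral>x. \<bar>f x - s i x\<bar> \<partial>M) + (\<integral>x. \<bar>s i x - g x\<bar> \<partial>M)"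
      by (intro Bochner_Integration.integral_add) auto
    also have "\<dots> < e" using g i by simp
    finally show ?case using g by blast
  }
qed

text \<open>An L1-convergent sequence of continuous functions has an almost everywhere convergent
  subsequence. Clamping it to \<open>{a..b}\<close> keeps continuity and the limit, and confines the
  values to the interval on which the later integrands are continuous.\<close>

lemma AE_approx_continuous:
  fixes M :: "'a::polish_space measure" and u :: "'a \<Rightarrow> real"
  assumes M: "sets M = sets borel" "finite_measure M" and u: "u \<in> borel_measurable borel"
    and ab: "\<And>x. u x \<in> {a..b}"
  obtains g :: "nat \<Rightarrow> 'a \<Rightarrow> real"
  where "\<And>k. continuous_on UNIV (g k)" "\<And>k x. g k x \<in> {a..b}" "AE x in M. (\<lambda>k. g k x) \<longlonglongrightarrow> u x"
proof -
  interpret finite_measure M by fact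
  have [measurable]: "u \<in> borel_measurable M"
    using u M by (simp cong: measurable_cong_sets)
  have "\<bar>u x\<bar> \<le> \<bar>a\<bar> + \<bar>b\<bar>" for x using ab[of x] by auto
  then have intu: "integrable M u" by (intro integrable_const_bound[where B="\<bar>a\<bar> + \<bar>b\<bar>"]) auto
  have "\<exists>g. \<forall>k. continuous_on UNIV (g k) \<and> bounded (range (g k)) \<and> (\<integral>x. \<bar>u x - g k x\<bar> \<partial>M) < inverse (real (Suc k))"
    using L1_approx_continuous[OF M intu] by (intro choice allI) auto
  then obtain g :: "nat \<Rightarrow> 'a \<Rightarrow> real" where g: "\<And>k. continuous_on UNIV (g k)" "\<And>k. bounded (range (g k))"
    "\<And>k. (\<integral>x. \<bar>u x - g k x\<bar> \<partial>M) < inverse (real (Suc k))" by blast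
  have intg: "integrable M (\<lambda>x. u x - g k x)" for k
  proof -
    obtain B where "\<And>x. \<bar>g k x\<bar> \<le> B" using g(2) by (auto simp: bounded_iff)
    moreover have "g k \<in> borel_measurable M"
      using g(1) M by (simp add: borel_measurable_continuous_onI cong: measurable_cong_sets)
    ultimately have "integrable M (g k)" by (intro integrable_const_bound[where B=B]) auto
    with intu show ?thesis by simp
  qed
  have "(\<lambda>k. \<integral>x. norm (u x - g k x) \<partial>M) \<longlonglongrightarrow> 0"
    by (rule tendsto_sandwich[OF _ _ tendsto_const LIMSEQ_inverse_real_of_nat])
      (use g(3) in \<open>auto intro!: always_eventually less_imp_le\<close>)
  from tendsto_L1_AE_subseq[OF intg this] obtain r where
    r: "strict_mono r" "AE x in M. (\<lambda>k. u x - g (r k) x) \<longlonglongrightarrow> 0" by blast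
  show ?thesis
  proof (rule that)
    show "continuous_on UNIV (\<lambda>x. max a (min b (g (r k) x)))" for k
      by (intro continuous_intros g)
    show "max a (min b (g (r k) x)) \<in> {a..b}" for k x using ab[of x] by auto
    show "AE x in M. (\<lambda>k. max a (min b (g (r k) x))) \<longlonglongrightarrow> u x"
      using r(2)
    proof eventually_elim
      case (elim x)
      have "(\<lambda>k. u x - (u x - g (r k) x)) \<longlonglongrightarrow> u x - 0"
        by (intro tendsto_intros elim)
      then have "(\<lambda>k. max a (min b (g (r k) x))) \<longlonglongrightarrow> max a (min b (u x))"
        by (intro tendsto_intros) simp
      then show ?case using ab[of x] by simp
    qed
  qed
qed

section \<open>Joint approximation for a pair of probability measures\<close>

lemma borel_prob_measuresD:
  assumes "P \<in> borel_prob_measures"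
  shows "sets P = sets borel" "prob_space P" "finite_measure P" "space P = UNIV"
proof -
  show "sets P = sets borel" "prob_space P"
    using assms by (auto simp: borel_prob_measures_def)
  then show "finite_measure P" "space P = UNIV"
    by (auto simp: prob_space.axioms dest: sets_eq_imp_space_eq)
qed

lemma finite_measure_sum_measure:
  assumes "finite_measure P" "finite_measure Q" "sets Q = sets P"
  shows "finite_measure (sum_measure P Q)"
proof
  have "space Q = space P" using assms(3) by (rule sets_eq_imp_space_eq)
  then show "emeasure (sum_measure P Q) (space (sum_measure P Q)) \<noteq> \<infinity>"
    using assms finite_measure.emeasure_finite[of P] finite_measure.emeasure_finite[of Q]
    by (simp add: emeasure_sum_measure ennreal_add_eq_top)
qed

lemma absolutely_continuous_sum_measure:
  assumes "sets Q = sets P"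
  shows "absolutely_continuous (sum_measure P Q) P" "absolutely_continuous (sum_measure P Q) Q"
  using assms by (auto simp: absolutely_continuous_def null_sets_def emeasure_sum_measure)

text \<open>Convergence almost everywhere for \<open>sum_measure P Q\<close> is inherited by both
  \<open>P\<close> and \<open>Q\<close>, so one sequence serves both integrals. As \<phi> and \<psi>
  are bounded on the compact interval, dominated convergence applies.\<close>

lemma integral_approx_continuous:
  fixes P Q :: "'a::polish_space measure" and u :: "'a \<Rightarrow> real" and \<phi> \<psi> :: "real \<Rightarrow> real"
  assumes P: "P \<in> borel_prob_measures" and Q: "Q \<in> borel_prob_measures"
    and u: "u \<in> borel_measurable borel" "\<And>x. u x \<in> {a..b}"
    and \<phi>: "continuous_on {a..b} \<phi>" and \<psi>: "continuous_on {a..b} \<psi>"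
  obtains g :: "nat \<Rightarrow> 'a \<Rightarrow> real"
  where "\<And>k. continuous_on UNIV (g k)" "\<And>k x. g k x \<in> {a..b}"
    "(\<lambda>k. (\<integral>x. \<phi> (g k x) \<partial>P) + (\<integral>x. \<psi> (g k x) \<partial>Q)) \<longlonglongrightarrow> (\<integral>x. \<phi> (u x) \<partial>P) + (\<integral>x. \<psi> (u x) \<partial>Q)"
proof -
  note P' = borel_prob_measuresD[OF P] and Q' = borel_prob_measuresD[OF Q]
  have QP: "sets Q = sets P" using P' Q' by simp
  obtain g :: "nat \<Rightarrow> 'a \<Rightarrow> real" where g: "\<And>k. continuous_on UNIV (g k)" "\<And>k x. g k x \<in> {a..b}"
    "AE x in sum_measure P Q. (\<lambda>k. g k x) \<longlonglongrightarrow> u x"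
    using AE_approx_continuous[of "sum_measure P Q" u a b]
      finite_measure_sum_measure[OF P'(3) Q'(3) QP] P' u by auto
  have lim: "(\<lambda>k. \<integral>x. f (g k x) \<partial>R) \<longlonglongrightarrow> (\<integral>x. f (u x) \<partial>R)"
    if R: "R \<in> borel_prob_measures" "absolutely_continuous (sum_measure P Q) R"
      and f: "continuous_on {a..b} f" for R and f :: "real \<Rightarrow> real"
  proof -
    note R' = borel_prob_measuresD[OF R(1)]
    interpret prob_space R by (rule R'(2))
    have "compact (f ` {a..b})" by (intro compact_continuous_image f compact_Icc)
    then obtain B where B: "\<And>y. y \<in> {a..b} \<Longrightarrow> \<bar>f y\<bar> \<le> B"
      using compact_imp_bounded by (fastforce simp: bounded_iff)
    have meas: "(\<lambda>x. f (v x)) \<in> borel_measurable R"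
      if v: "v \<in> borel_measurable borel" "\<And>x. v x \<in> {a..b}" for v
    proof -
      \<comment> \<open>Continuity of \<open>f\<close> is known only on \<open>{a..b}\<close>, so
        \<open>v\<close> is regarded as a map into that subspace before composing.\<close>
      have "v \<in> measurable R (restrict_space borel {a..b})"
        using v R' by (intro measurable_restrict_space2) (auto cong: measurable_cong_sets)
      from measurable_compose[OF this borel_measurable_continuous_on_restrict[OF f]]
      show ?thesis .
    qed
    have ae: "AE x in R. (\<lambda>k. g k x) \<longlonglongrightarrow> u x"
      by (rule absolutely_continuous_AE[OF _ R(2) g(3)]) (use R' P' in simp)
    show ?thesis
    proof (rule integral_dominated_convergence[where w="\<lambda>_. B"])
      show "AE x in R. (\<lambda>k. f (g k x)) \<longlonglongrightarrow> f (u x)"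
        using ae
      proof eventually_elim
        case (elim x)
        then show ?case
          using continuous_on_tendsto_compose[OF f elim] g(2) u(2) by simp
      qed
    qed (use B g(2) u meas borel_measurable_continuous_onI[OF g(1)] in auto)
  qed
  show ?thesis
    using that[of g] g tendsto_add[OF lim[OF P _ \<phi>] lim[OF Q _ \<psi>]]
      absolutely_continuous_sum_measure[OF QP] by blast
qed

section \<open>Weak continuity of integrals of bounded continuous functions\<close>

lemma continuous_map_weak_integral:
  fixes f :: "'a::topological_space \<Rightarrow> real"
  assumes "continuous_on UNIV f" "bounded (range f)"
  shows "continuous_map weak_topology euclideanreal (\<lambda>P. \<integral>x. f x \<partial>P)"
  unfolding continuous_map_def
proof (intro conjI allI impI)
  fix U :: "real set" assume "openin euclideanreal U"
  then show "openin weak_topology {P \<in> topspace weak_topology. (\<integral>x. f x \<partial>P) \<in> U}"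
    unfolding topspace_weak_topology unfolding weak_topology_def
    using assms by (intro topology_generated_by_Basis) auto
qed auto

lemma continuous_map_prod_weak_integral:
  fixes f h :: "'a::topological_space \<Rightarrow> real"
  assumes "continuous_on UNIV f" "bounded (range f)" "continuous_on UNIV h" "bounded (range h)"
  shows "continuous_map (prod_topology weak_topology weak_topology) euclideanreal
    (\<lambda>z. (\<integral>x. f x \<partial>fst z) + (\<integral>x. h x \<partial>snd z))"
  using continuous_map_compose[OF continuous_map_fst continuous_map_weak_integral[OF assms(1,2)], of weak_topology]
    continuous_map_compose[OF continuous_map_snd continuous_map_weak_integral[OF assms(3,4)], of weak_topology]
  by (intro continuous_map_add) (simp_all add: o_def)

section \<open>Densities normalised to lie between 0 and 1\<close>

text \<open>Nonnegative densities \<open>d\<close>, \<open>e\<close> with respect to the sum measure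
  are divided by \<open>d + e\<close>, and the base measure is reweighted by \<open>d + e\<close>.
  The bounds then hold at every point, which makes the regularised quotients of \<open>p\<close> and
  \<open>q\<close> bounded functions.\<close>

lemma densities_le_1:
  assumes P: "P \<in> borel_prob_measures" and Q: "Q \<in> borel_prob_measures"
  obtains \<mu> and p q :: "'a::topological_space \<Rightarrow> real"
  where "finite_measure \<mu>" "sets \<mu> = sets borel" "p \<in> borel_measurable \<mu>" "q \<in> borel_measurable \<mu>"
    "\<And>x. 0 \<le> p x" "\<And>x. p x \<le> 1" "\<And>x. 0 \<le> q x" "\<And>x. q x \<le> 1"
    "density \<mu> p = P" "density \<mu> q = Q"
proof -
  note P' = borel_prob_measuresD[OF P] and Q' = borel_prob_measuresD[OF Q]
  have QP: "sets Q = sets P" using P' Q' by simp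
  define \<nu> where "\<nu> = sum_measure P Q"
  interpret \<nu>: finite_measure \<nu>
    unfolding \<nu>_def by (rule finite_measure_sum_measure[OF P'(3) Q'(3) QP])
  have sets\<nu>: "sets \<nu> = sets borel" using P' by (simp add: \<nu>_def)
  have ex: "\<exists>d. d \<in> borel_measurable \<nu> \<and> (\<forall>x. 0 \<le> d x) \<and> density \<nu> (\<lambda>x. ennreal (d x)) = R"
    if R: "R \<in> borel_prob_measures" "absolutely_continuous \<nu> R" for R
  proof -
    note R' = borel_prob_measuresD[OF R(1)]
    have RS: "sets R = sets \<nu>" using R' sets\<nu> by simp
    obtain D where D: "D \<in> borel_measurable \<nu>" "AE x in \<nu>. RN_deriv \<nu> R x = ennreal (D x)" "\<And>x. 0 \<le> D x"
      using \<nu>.real_RN_deriv[OF R'(3) R(2) RS] by metis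
    have "density \<nu> (\<lambda>x. ennreal (D x)) = density \<nu> (RN_deriv \<nu> R)"
      using D by (intro density_cong) auto
    also have "\<dots> = R" by (rule \<nu>.density_RN_deriv[OF R(2) RS])
    finally show ?thesis using D by blast
  qed
  obtain d where d: "d \<in> borel_measurable \<nu>" "\<And>x. 0 \<le> d x" "density \<nu> (\<lambda>x. ennreal (d x)) = P"
    using ex[OF P] absolutely_continuous_sum_measure[OF QP] by (auto simp: \<nu>_def)
  obtain e where e: "e \<in> borel_measurable \<nu>" "\<And>x. 0 \<le> e x" "density \<nu> (\<lambda>x. ennreal (e x)) = Q"
    using ex[OF Q] absolutely_continuous_sum_measure[OF QP] by (auto simp: \<nu>_def)
  note [measurable] = d(1) e(1)
  define \<mu> where "\<mu> = density \<nu> (\<lambda>x. ennreal (d x + e x))"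
  have "emeasure \<mu> (space \<mu>) = (\<integral>\<^sup>+x. ennreal (d x) \<partial>\<nu>) + (\<integral>\<^sup>+x. ennreal (e x) \<partial>\<nu>)"
    using d(2) e(2) by (simp add: \<mu>_def emeasure_density nn_integral_add cong: nn_integral_cong)
  also have "(\<integral>\<^sup>+x. ennreal (d x) \<partial>\<nu>) = emeasure P (space P)"
    by (subst (1 2) d(3)[symmetric]) (simp add: emeasure_density cong: nn_integral_cong)
  also have "(\<integral>\<^sup>+x. ennreal (e x) \<partial>\<nu>) = emeasure Q (space Q)"
    by (subst (1 2) e(3)[symmetric]) (simp add: emeasure_density cong: nn_integral_cong)
  finally have fin: "finite_measure \<mu>"
    using P'(3) Q'(3) by (intro finite_measureI) (simp add: ennreal_add_eq_top finite_measure.emeasure_finite)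
  have dens: "density \<mu> (\<lambda>x. ennreal (c x / (d x + e x))) = density \<nu> (\<lambda>x. ennreal (c x))"
    if c: "c \<in> borel_measurable \<nu>" "\<And>x. 0 \<le> c x" "\<And>x. c x \<le> d x + e x" for c
  proof -
    have eq: "ennreal (d x + e x) * ennreal (c x / (d x + e x)) = ennreal (c x)" for x
    proof -
      \<comment> \<open>Where \<open>d x + e x = 0\<close> the quotient is 0 by convention, and
        \<open>c x \<le> d x + e x\<close> forces \<open>c x = 0\<close>.\<close>
      have "(d x + e x) * (c x / (d x + e x)) = c x"
        using c(2,3)[of x] by (cases "d x + e x = 0") auto
      then show ?thesis using d(2)[of x] e(2)[of x] c(2)[of x] by (simp flip: ennreal_mult del: ennreal_plus)
    qed
    show ?thesis
      unfolding \<mu>_def using c(1) by (subst density_density_eq) (auto simp: eq)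
  qed
  show ?thesis
  proof (rule that[OF fin])
    show "density \<mu> (\<lambda>x. ennreal (d x / (d x + e x))) = P"
      using dens[of d] d e by simp
    show "density \<mu> (\<lambda>x. ennreal (e x / (d x + e x))) = Q"
      using dens[of e] d e by simp
    show "(\<lambda>x. d x / (d x + e x)) \<in> borel_measurable \<mu>" "(\<lambda>x. e x / (d x + e x)) \<in> borel_measurable \<mu>"
      by (simp_all add: \<mu>_def)
    show "sets \<mu> = sets borel" by (simp add: \<mu>_def sets\<nu>)
  qed (use d(2) e(2) in \<open>auto simp: divide_le_eq_1 add_nonneg_nonneg add_nonneg_eq_0_iff less_le\<close>)
qed

section \<open>The variational formula\<close>

text \<open>Weighted arithmetic-geometric mean with weights \<alpha> and
  \<open>1 - \<alpha>\<close>, applied to \<open>u powr (1 - \<alpha>) * p\<close> and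
  \<open>u powr (- \<alpha>) * q\<close>; the powers of \<open>u\<close> cancel in the geometric
  mean.\<close>

lemma young_lt_1:
  fixes \<alpha> p q u :: real
  assumes "0 < \<alpha>" "\<alpha> < 1" "0 \<le> p" "0 \<le> q" "0 < u"
  shows "p powr \<alpha> * q powr (1 - \<alpha>) \<le> \<alpha> * u powr (1 - \<alpha>) * p + (1 - \<alpha>) * u powr (- \<alpha>) * q"
proof (cases "p = 0 \<or> q = 0")
  case True
  then show ?thesis using assms by auto
next
  case False
  then have pq: "0 < p" "0 < q" using assms by auto
  have "(u powr (1 - \<alpha>) * p) powr \<alpha> * (u powr (- \<alpha>) * q) powr (1 - \<alpha>)
      = (u powr ((1 - \<alpha>) * \<alpha>) * u powr (- \<alpha> * (1 - \<alpha>))) * (p powr \<alpha> * q powr (1 - \<alpha>))"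
    using pq assms by (simp add: powr_mult powr_powr)
  also have "u powr ((1 - \<alpha>) * \<alpha>) * u powr (- \<alpha> * (1 - \<alpha>)) = 1"
    using assms by (simp flip: powr_add)
  finally show ?thesis
    using Youngs_inequality_0[of \<alpha> "1 - \<alpha>" "u powr (1 - \<alpha>) * p" "u powr (- \<alpha>) * q"] assms pq
    by (simp add: mult.assoc)
qed

text \<open>Young's inequality with weights \<open>1 / \<alpha>\<close> and
  \<open>(\<alpha> - 1) / \<alpha>\<close>, applied to
  \<open>p powr \<alpha> / q powr (\<alpha> - 1)\<close> and \<open>u powr \<alpha> * q\<close>,
  then multiplied by \<alpha>. Positivity of \<open>q\<close> matters: real division by zero yields
  0, which would falsify the bound for positive \<open>p\<close> and \<open>u\<close>.\<close>

lemma young_gt_1: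
  fixes \<alpha> p q u :: real
  assumes "1 < \<alpha>" "0 \<le> p" "0 < q" "0 \<le> u"
  shows "\<alpha> * u powr (\<alpha> - 1) * p \<le> p powr \<alpha> / q powr (\<alpha> - 1) + (\<alpha> - 1) * u powr \<alpha> * q"
proof (cases "p = 0 \<or> u = 0")
  case True
  then show ?thesis using assms by auto
next
  case False
  then have pu: "0 < p" "0 < u" using assms by auto
  have "(p powr \<alpha> / q powr (\<alpha> - 1)) powr (1 / \<alpha>) * (u powr \<alpha> * q) powr ((\<alpha> - 1) / \<alpha>)
      = p * u powr (\<alpha> - 1) * (q powr ((\<alpha> - 1) / \<alpha>) / q powr ((\<alpha> - 1) / \<alpha>))"
    using pu assms by (simp add: powr_mult powr_powr powr_divide)
  also have "\<dots> = p * u powr (\<alpha> - 1)" using assms by simp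
  finally have "p * u powr (\<alpha> - 1) \<le> 1 / \<alpha> * (p powr \<alpha> / q powr (\<alpha> - 1)) + (\<alpha> - 1) / \<alpha> * (u powr \<alpha> * q)"
    using Youngs_inequality_0[of "1 / \<alpha>" "(\<alpha> - 1) / \<alpha>" "p powr \<alpha> / q powr (\<alpha> - 1)" "u powr \<alpha> * q"] assms pu
    by (simp add: field_simps)
  then have "\<alpha> * (p * u powr (\<alpha> - 1)) \<le> \<alpha> * (1 / \<alpha> * (p powr \<alpha> / q powr (\<alpha> - 1)) + (\<alpha> - 1) / \<alpha> * (u powr \<alpha> * q))"
    using assms by (intro mult_left_mono) auto
  also have "\<dots> = p powr \<alpha> / q powr (\<alpha> - 1) + (\<alpha> - 1) * u powr \<alpha> * q"
    using assms by (simp add: distrib_left)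
  finally show ?thesis by (simp add: mult_ac)
qed

text \<open>
  A linearised form of Hoelder's inequality \<open>I\<^sub>a \<le> I\<^sub>b\<^sup>\<theta>\<close>, which follows on integrating and
  choosing \<open>i = I\<^sub>b\<close>.
\<close>

lemma renyi_integrand_interpolate:
  assumes ab: "0 < a" "0 < b" "a < 1 \<and> b < 1 \<and> b < a \<or> 1 < a \<and> a < b" and pq: "0 \<le> p" "0 \<le> q" and i: "0 < (i::real)"
  defines "\<theta> \<equiv> (a - 1) / (b - 1)"
  shows "renyi_integrand a p q \<le> ennreal ((1 - \<theta>) * i powr \<theta>) * ennreal p
     + ennreal (\<theta> * i powr (\<theta> - 1)) * renyi_integrand b p q"
proof -
  have \<theta>: "0 < \<theta>" "\<theta> < 1" using ab by (auto simp: \<theta>_def field_simps)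
  have ab1: "\<theta> * (b - 1) = a - 1" using ab by (auto simp: \<theta>_def)
  \<comment> \<open>The order \<open>a\<close> is the convex combination of 1 and \<open>b\<close>
    with weights \<open>1 - \<theta>\<close> and \<theta>, so the integrand of order
    \<open>a\<close> is a weighted geometric mean of \<open>p\<close> and the integrand of order
    \<open>b\<close>.\<close>
  then have \<theta>b: "1 - \<theta> + \<theta> * b = a" by (simp add: algebra_simps)
  have ri: "renyi_integrand c p q = ennreal (p powr c * q powr (1 - c))" if "0 < q" for c
    using that by (auto simp: renyi_integrand_def divide_ennreal powr_minus_divide[symmetric] divide_inverse powr_minus[symmetric])
  consider "p = 0" | "p > 0" "q = 0" | "p > 0" "q > 0" using pq by linarith
  then show ?thesis
  proof cases
    case 1
    then show ?thesis using ab by (auto simp: renyi_integrand_def)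
  next
    case 2
    \<comment> \<open>With \<open>q = 0 < p\<close> both integrands are 0 for orders below 1 and
      both are infinite for orders above 1.\<close>
    then show ?thesis using ab \<theta> i
      by (auto simp: renyi_integrand_def divide_ennreal_def ennreal_mult_top ennreal_mult_eq_top_iff)
  next
    case 3
    define X where "X = p powr b * q powr (1 - b)"
    have X: "X > 0" using 3 by (simp add: X_def)
    have "p powr a * q powr (1 - a) = p powr (1 - \<theta>) * X powr \<theta>"
    proof -
      have "p powr (1 - \<theta>) * X powr \<theta> = p powr (1 - \<theta> + \<theta> * b) * q powr (\<theta> * (1 - b))"
        using 3 by (simp add: X_def powr_mult powr_powr powr_add mult_ac)
      moreover have "\<theta> * (1 - b) = 1 - a" using ab1 by (simp add: algebra_simps)
      ultimately show ?thesis by (simp add: \<theta>b)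
    qed
    also have "\<dots> = i powr \<theta> * (p powr (1 - \<theta>) * (X / i) powr \<theta>)"
      using i X by (simp add: powr_divide)
    also have "\<dots> \<le> i powr \<theta> * ((1 - \<theta>) * p + \<theta> * (X / i))"
      using Youngs_inequality_0[of "1 - \<theta>" \<theta> p "X / i"] \<theta> 3 X i by (intro mult_left_mono) auto
    also have "\<dots> = (1 - \<theta>) * i powr \<theta> * p + \<theta> * i powr (\<theta> - 1) * X"
      using i by (simp add: powr_diff algebra_simps)
    finally show ?thesis
      using 3 \<theta> X by (simp add: ri X_def[symmetric] flip: ennreal_mult ennreal_plus)
  qed
qed

lemma powr_at_top:
  fixes s :: real
  assumes "0 < s"
  shows "filterlim (\<lambda>x. x powr s) at_top at_top"
proof -
  have "filterlim (\<lambda>x. exp (s * ln x)) at_top at_top"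
    by (rule filterlim_compose[OF exp_at_top])
      (rule filterlim_tendsto_pos_mult_at_top[OF tendsto_const assms ln_at_top])
  then show ?thesis
    by (rule filterlim_cong[THEN iffD1, rotated 3])
      (auto simp: powr_def intro!: eventually_mono[OF eventually_gt_at_top[of 0]])
qed

section \<open>Variational bounds for the Renyi integral and near-optimal functions\<close>

lemma nn_integral_density_bounded:
  fixes f p :: "'a::topological_space \<Rightarrow> real"
  assumes P: "P \<in> borel_prob_measures" and p: "p \<in> borel_measurable \<mu>" "\<And>x. 0 \<le> p x" "density \<mu> p = P"
    and f: "f \<in> borel_measurable borel" "\<And>x. 0 \<le> f x" "\<And>x. f x \<le> B"
  shows "(\<integral>\<^sup>+x. ennreal (f x * p x) \<partial>\<mu>) = ennreal (\<integral>x. f x \<partial>P)"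
proof -
  interpret prob_space P using borel_prob_measuresD[OF P] by simp
  have sets: "sets P = sets borel" using borel_prob_measuresD[OF P] by simp
  then have "sets \<mu> = sets borel" unfolding p(3)[symmetric] sets_density .
  then have f\<mu>: "f \<in> borel_measurable \<mu>" and fP: "f \<in> borel_measurable P"
    using f sets by (simp_all cong: measurable_cong_sets)
  have "integrable P f"
    using f fP by (intro integrable_const_bound[where B=B]) auto
  then have "ennreal (\<integral>x. f x \<partial>P) = (\<integral>\<^sup>+x. f x \<partial>density \<mu> p)"
    unfolding p(3) using f by (intro nn_integral_eq_integral[symmetric]) auto
  also have "\<dots> = (\<integral>\<^sup>+x. ennreal (f x * p x) \<partial>\<mu>)"
    using p f f\<mu> by (subst nn_integral_density) (auto simp: ennreal_mult mult.commute)
  finally show ?thesis by simp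
qed

lemma nn_integral_two_densities_bounded:
  fixes f h p q :: "'a::topological_space \<Rightarrow> real"
  assumes P: "P \<in> borel_prob_measures" and p: "p \<in> borel_measurable \<mu>" "\<And>x. 0 \<le> p x" "density \<mu> p = P"
    and Q: "Q \<in> borel_prob_measures" and q: "q \<in> borel_measurable \<mu>" "\<And>x. 0 \<le> q x" "density \<mu> q = Q"
    and f: "f \<in> borel_measurable borel" "\<And>x. 0 \<le> f x" "\<And>x. f x \<le> B"
    and h: "h \<in> borel_measurable borel" "\<And>x. 0 \<le> h x" "\<And>x. h x \<le> C"
  shows "(\<integral>\<^sup>+x. ennreal (f x * p x + h x * q x) \<partial>\<mu>) = ennreal ((\<integral>x. f x \<partial>P) + (\<integral>x. h x \<partial>Q))"
proof -
  have "sets \<mu> = sets borel" using borel_prob_measuresD(1)[OF P] unfolding p(3)[symmetric] sets_density .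
  then have [measurable]: "f \<in> borel_measurable \<mu>" "h \<in> borel_measurable \<mu>"
    using f h by (simp_all cong: measurable_cong_sets)
  note [measurable] = p(1) q(1)
  have "(\<integral>\<^sup>+x. ennreal (f x * p x + h x * q x) \<partial>\<mu>)
      = (\<integral>\<^sup>+x. ennreal (f x * p x) \<partial>\<mu>) + (\<integral>\<^sup>+x. ennreal (h x * q x) \<partial>\<mu>)"
    using f h p q by (subst nn_integral_add[symmetric]) auto
  then show ?thesis
    using f h by (simp add: nn_integral_density_bounded[OF P p f] nn_integral_density_bounded[OF Q q h])
qed

text \<open>The integrated form of \<open>young_lt_1\<close>. The lower bound \<open>a > 0\<close>
  keeps the negative power of \<open>g\<close> bounded, so both integrals are finite.\<close>

lemma renyi_integral_le_functional:
  fixes P Q :: "'a::topological_space measure"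
  assumes \<alpha>: "0 < \<alpha>" "\<alpha> < 1" and P: "P \<in> borel_prob_measures" and Q: "Q \<in> borel_prob_measures"
    and g: "g \<in> borel_measurable borel" "\<And>x. g x \<in> {a..b}" "0 < a"
  shows "renyi_integral \<alpha> P Q \<le>
    ennreal ((\<integral>x. \<alpha> * g x powr (1 - \<alpha>) \<partial>P) + (\<integral>x. (1 - \<alpha>) * g x powr (- \<alpha>) \<partial>Q))"
proof -
  obtain \<mu> and p q :: "'a \<Rightarrow> real" where m: "finite_measure \<mu>" "sets \<mu> = sets borel"
    and p: "p \<in> borel_measurable \<mu>" "\<And>x. 0 \<le> p x" "density \<mu> p = P"
    and q: "q \<in> borel_measurable \<mu>" "\<And>x. 0 \<le> q x" "density \<mu> q = Q"
    using densities_le_1[OF P Q] by metis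
  have g0: "0 < g x" for x using g(2)[of x] g(3) by auto
  have "renyi_integral \<alpha> P Q = (\<integral>\<^sup>+x. renyi_integrand \<alpha> (p x) (q x) \<partial>\<mu>)"
    using \<alpha> m p q borel_prob_measuresD[OF P] borel_prob_measuresD[OF Q]
    by (intro renyi_integral_eq) (auto simp: finite_measure.sigma_finite_measure finite_measure_def)
  also have "\<dots> \<le> (\<integral>\<^sup>+x. ennreal (\<alpha> * g x powr (1 - \<alpha>) * p x + (1 - \<alpha>) * g x powr (- \<alpha>) * q x) \<partial>\<mu>)"
    unfolding renyi_integrand_def using \<alpha> p(2) q(2) g0
    by (intro nn_integral_mono) (simp add: ennreal_leI young_lt_1 del: ennreal_plus)
  also have "\<dots> = ennreal ((\<integral>x. \<alpha> * g x powr (1 - \<alpha>) \<partial>P) + (\<integral>x. (1 - \<alpha>) * g x powr (- \<alpha>) \<partial>Q))"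
  proof (rule nn_integral_two_densities_bounded[OF P p Q q])
    show "\<alpha> * g x powr (1 - \<alpha>) \<le> \<alpha> * b powr (1 - \<alpha>)" for x
      using \<alpha> g(2)[of x] g0[of x] by (intro mult_left_mono powr_mono2) auto
    show "(1 - \<alpha>) * g x powr (- \<alpha>) \<le> (1 - \<alpha>) * a powr (- \<alpha>)" for x
      using \<alpha> g(2)[of x] g(3) by (intro mult_left_mono powr_mono2') auto
  qed (use \<alpha> g(1) in auto)
  finally show ?thesis .
qed

text \<open>The pointwise optimum \<open>q / p\<close> may vanish or be undefined, so \<epsilon> is
  added to both densities. Young's inequality then bounds the functional by the integral of
  \<open>(p + \<epsilon>) powr \<alpha> * (q + \<epsilon>) powr (1 - \<alpha>)\<close>, which tends
  to the Renyi integral as \<epsilon> decreases to 0.\<close>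

lemma functional_approx_renyi_integral_lt_1:
  fixes P Q :: "'a::topological_space measure"
  assumes \<alpha>: "0 < \<alpha>" "\<alpha> < 1" and P: "P \<in> borel_prob_measures" and Q: "Q \<in> borel_prob_measures"
    and r: "renyi_integral \<alpha> P Q < r"
  obtains u a b where "u \<in> borel_measurable borel" "\<And>x. u x \<in> {a..b}" "0 < a"
    "ennreal ((\<integral>x. \<alpha> * u x powr (1 - \<alpha>) \<partial>P) + (\<integral>x. (1 - \<alpha>) * u x powr (- \<alpha>) \<partial>Q)) < r"
proof -
  obtain \<mu> and p q :: "'a \<Rightarrow> real" where m: "finite_measure \<mu>" "sets \<mu> = sets borel"
    and p: "p \<in> borel_measurable \<mu>" "\<And>x. 0 \<le> p x" "density \<mu> p = P"
    and q: "q \<in> borel_measurable \<mu>" "\<And>x. 0 \<le> q x" "density \<mu> q = Q"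
    and le1: "\<And>x. p x \<le> 1" "\<And>x. q x \<le> 1"
    using densities_le_1[OF P Q] by metis
  interpret finite_measure \<mu> by (rule m)
  note [measurable] = p(1) q(1)
  have pqb: "p \<in> borel_measurable borel" "q \<in> borel_measurable borel"
    using p q m by (simp_all cong: measurable_cong_sets)
  have I: "renyi_integral \<alpha> P Q = (\<integral>\<^sup>+x. ennreal (p x powr \<alpha> * q x powr (1 - \<alpha>)) \<partial>\<mu>)"
    using \<alpha> m p q borel_prob_measuresD[OF P] borel_prob_measuresD[OF Q]
    by (subst renyi_integral_eq[where p=p and q=q and \<mu>=\<mu>])
      (auto simp: finite_measure.sigma_finite_measure finite_measure_def renyi_integrand_def)
  let ?e = "\<lambda>n. inverse (real (Suc n))"
  have e: "0 < ?e n" "?e n \<le> 1" for n by (auto simp: field_simps)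
  let ?F = "\<lambda>n x. (p x + ?e n) powr \<alpha> * (q x + ?e n) powr (1 - \<alpha>)"
  have "(\<lambda>n. \<integral>\<^sup>+x. ennreal (?F n x) \<partial>\<mu>) \<longlonglongrightarrow> (\<integral>\<^sup>+x. ennreal (p x powr \<alpha> * q x powr (1 - \<alpha>)) \<partial>\<mu>)"
  \<comment> \<open>Both bases are at most 2 because \<open>p\<close>, \<open>q\<close> and
    \<open>?e n\<close> are at most 1, and the exponents sum to 1. The constant 2 is integrable
    since \<mu> is finite.\<close>
  proof (rule nn_integral_dominated_convergence[where w="\<lambda>_. 2"])
    have "?F n x \<le> 2" for n x
    proof -
      have "?F n x \<le> 2 powr \<alpha> * 2 powr (1 - \<alpha>)"
        using \<alpha> p(2)[of x] q(2)[of x] le1[of x] e[of n] by (intro mult_mono powr_mono2) auto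
      then show ?thesis by (simp flip: powr_add)
    qed
    then show "AE x in \<mu>. ennreal (?F n x) \<le> 2" for n
      by (auto simp: ennreal_le_iff2 simp flip: ennreal_numeral intro!: AE_I2)
    have "(\<lambda>n. ?F n x) \<longlonglongrightarrow> (p x + 0) powr \<alpha> * (q x + 0) powr (1 - \<alpha>)" for x
      using \<alpha> p(2)[of x] q(2)[of x] e
      by (intro tendsto_mult tendsto_powr2 tendsto_add tendsto_const LIMSEQ_inverse_real_of_nat)
        (auto intro!: always_eventually add_nonneg_nonneg less_imp_le)
    then show "AE x in \<mu>. (\<lambda>n. ennreal (?F n x)) \<longlonglongrightarrow> ennreal (p x powr \<alpha> * q x powr (1 - \<alpha>))"
      by (intro AE_I2 tendsto_ennrealI) simp
  qed (auto simp: ennreal_mult_less_top less_top emeasure_eq_measure)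
  then obtain n where n: "(\<integral>\<^sup>+x. ennreal (?F n x) \<partial>\<mu>) < r"
    using order_tendstoD(2)[OF _ r[unfolded I]] by (force simp: eventually_sequentially)
  define \<epsilon> where "\<epsilon> = ?e n"
  have \<epsilon>: "0 < \<epsilon>" "\<epsilon> \<le> 1" using e by (auto simp: \<epsilon>_def)
  \<comment> \<open>The optimal \<open>q / p\<close>, regularised; it is bounded and bounded away from 0 as \<open>p, q \<le> 1\<close>.\<close>
  define u where "u = (\<lambda>x. (q x + \<epsilon>) / (p x + \<epsilon>))"
  have u: "u \<in> borel_measurable borel" using pqb by (simp add: u_def)
  have ub: "u x \<in> {\<epsilon> / (1 + \<epsilon>)..(1 + \<epsilon>) / \<epsilon>}" for x
    using p(2)[of x] q(2)[of x] le1[of x] \<epsilon> unfolding u_def atLeastAtMost_iff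
    by (intro conjI frac_le) auto
  have a: "0 < \<epsilon> / (1 + \<epsilon>)" using \<epsilon> by simp
  have u0: "0 < u x" for x using ub[of x] a by auto
  have "ennreal ((\<integral>x. \<alpha> * u x powr (1 - \<alpha>) \<partial>P) + (\<integral>x. (1 - \<alpha>) * u x powr (- \<alpha>) \<partial>Q))
     = (\<integral>\<^sup>+x. ennreal (\<alpha> * u x powr (1 - \<alpha>) * p x + (1 - \<alpha>) * u x powr (- \<alpha>) * q x) \<partial>\<mu>)"
  proof (rule nn_integral_two_densities_bounded[OF P p Q q, symmetric])
    show "\<alpha> * u x powr (1 - \<alpha>) \<le> \<alpha> * ((1 + \<epsilon>) / \<epsilon>) powr (1 - \<alpha>)" for x
      using \<alpha> ub[of x] u0[of x] by (intro mult_left_mono powr_mono2) auto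
    show "(1 - \<alpha>) * u x powr (- \<alpha>) \<le> (1 - \<alpha>) * (\<epsilon> / (1 + \<epsilon>)) powr (- \<alpha>)" for x
      using \<alpha> ub[of x] a by (intro mult_left_mono powr_mono2') auto
  qed (use \<alpha> u in auto)
  also have "\<dots> \<le> (\<integral>\<^sup>+x. ennreal (?F n x) \<partial>\<mu>)"
  proof (intro nn_integral_mono ennreal_leI)
    fix x
    define s t where "s = p x + \<epsilon>" and "t = q x + \<epsilon>"
    have st: "0 < s" "0 < t" "p x \<le> s" "q x \<le> t" using \<epsilon> p(2)[of x] q(2)[of x] by (auto simp: s_def t_def)
    have ux: "u x = t / s" by (simp add: u_def s_def t_def)
    \<comment> \<open>\<open>u x = t / s\<close> is the equality case of Young's inequality for
      \<open>s\<close> and \<open>t\<close>: both terms carry the same product, with weights summing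
      to 1.\<close>
    have 1: "u x powr (1 - \<alpha>) * s = s powr \<alpha> * t powr (1 - \<alpha>)"
      using st by (simp add: ux powr_divide powr_diff)
    have 2: "u x powr (- \<alpha>) * t = s powr \<alpha> * t powr (1 - \<alpha>)"
      using st by (simp add: ux powr_divide powr_diff powr_minus field_simps)
    have "\<alpha> * u x powr (1 - \<alpha>) * p x + (1 - \<alpha>) * u x powr (- \<alpha>) * q x
        \<le> \<alpha> * u x powr (1 - \<alpha>) * s + (1 - \<alpha>) * u x powr (- \<alpha>) * t"
      using st \<alpha> by (intro add_mono mult_left_mono) auto
    also have "\<dots> = \<alpha> * (u x powr (1 - \<alpha>) * s) + (1 - \<alpha>) * (u x powr (- \<alpha>) * t)"
      by (simp only: mult.assoc)
    also have "\<dots> = s powr \<alpha> * t powr (1 - \<alpha>)"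
      unfolding 1 2 by (simp add: algebra_simps)
    finally show "\<alpha> * u x powr (1 - \<alpha>) * p x + (1 - \<alpha>) * u x powr (- \<alpha>) * q x \<le> ?F n x"
      by (simp add: s_def t_def \<epsilon>_def)
  qed
  also note n
  finally show ?thesis using that u ub a by blast
qed

text \<open>The integrated form of \<open>young_gt_1\<close>. Its negative term is first kept on the
  larger side, because subtraction on \<open>ennreal\<close> is truncated. If the functional is
  negative, \<open>ennreal\<close> sends it to 0 and the bound is trivial.\<close>

lemma functional_le_renyi_integral:
  fixes P Q :: "'a::topological_space measure"
  assumes \<alpha>: "1 < \<alpha>" and P: "P \<in> borel_prob_measures" and Q: "Q \<in> borel_prob_measures"
    and g: "g \<in> borel_measurable borel" "\<And>x. g x \<in> {0..b}"
  shows "ennreal ((\<integral>x. \<alpha> * g x powr (\<alpha> - 1) \<partial>P) + (\<integral>x. (1 - \<alpha>) * g x powr \<alpha> \<partial>Q)) \<le> renyi_integral \<alpha> P Q"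
proof -
  obtain \<mu> and p q :: "'a \<Rightarrow> real" where m: "finite_measure \<mu>" "sets \<mu> = sets borel"
    and p: "p \<in> borel_measurable \<mu>" "\<And>x. 0 \<le> p x" "density \<mu> p = P"
    and q: "q \<in> borel_measurable \<mu>" "\<And>x. 0 \<le> q x" "density \<mu> q = Q"
    using densities_le_1[OF P Q] by metis
  note [measurable] = p(1) q(1)
  have [measurable]: "g \<in> borel_measurable \<mu>" using g m by (simp cong: measurable_cong_sets)
  have I: "renyi_integral \<alpha> P Q = (\<integral>\<^sup>+x. renyi_integrand \<alpha> (p x) (q x) \<partial>\<mu>)"
    using \<alpha> m p q borel_prob_measuresD[OF P] borel_prob_measuresD[OF Q]
    by (intro renyi_integral_eq) (auto simp: finite_measure.sigma_finite_measure finite_measure_def)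
  have g0: "0 \<le> g x" "g x \<le> b" for x using g(2)[of x] by auto
  let ?B = "\<integral>x. (\<alpha> - 1) * g x powr \<alpha> \<partial>Q"
  have B: "(\<integral>\<^sup>+x. ennreal ((\<alpha> - 1) * g x powr \<alpha> * q x) \<partial>\<mu>) = ennreal ?B"
    by (rule nn_integral_density_bounded[OF Q q, where B="(\<alpha> - 1) * b powr \<alpha>"])
      (use \<alpha> g g0 in \<open>auto intro!: mult_left_mono powr_mono2\<close>)
  have "ennreal (\<integral>x. \<alpha> * g x powr (\<alpha> - 1) \<partial>P) = (\<integral>\<^sup>+x. ennreal (\<alpha> * g x powr (\<alpha> - 1) * p x) \<partial>\<mu>)"
    by (rule nn_integral_density_bounded[OF P p, where B="\<alpha> * b powr (\<alpha> - 1)", symmetric])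
      (use \<alpha> g g0 in \<open>auto intro!: mult_left_mono powr_mono2\<close>)
  also have "\<dots> \<le> (\<integral>\<^sup>+x. renyi_integrand \<alpha> (p x) (q x) + ennreal ((\<alpha> - 1) * g x powr \<alpha> * q x) \<partial>\<mu>)"
  proof (rule nn_integral_mono)
    fix x
    show "ennreal (\<alpha> * g x powr (\<alpha> - 1) * p x) \<le> renyi_integrand \<alpha> (p x) (q x) + ennreal ((\<alpha> - 1) * g x powr \<alpha> * q x)"
    proof (cases "q x = 0")
      case True
      \<comment> \<open>At \<open>q x = 0\<close> the integrand is infinite unless
        \<open>p x = 0\<close>, in which case the left side vanishes.\<close>
      then show ?thesis using \<alpha> p(2)[of x]
        by (cases "p x = 0") (auto simp: renyi_integrand_def divide_ennreal_def ennreal_mult_top)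
    next
      case False
      then have "0 < q x" using q(2)[of x] by simp
      with young_gt_1[OF \<alpha> p(2) this g0(1), of x x] \<alpha> show ?thesis
        by (simp add: renyi_integrand_def divide_ennreal ennreal_leI flip: ennreal_plus)
    qed
  qed
  also have "\<dots> = renyi_integral \<alpha> P Q + ennreal ?B"
    unfolding I B[symmetric]
    by (rule nn_integral_add) (auto simp: renyi_integrand_def)
  finally have "ennreal (\<integral>x. \<alpha> * g x powr (\<alpha> - 1) \<partial>P) - ennreal ?B \<le> renyi_integral \<alpha> P Q"
    by (simp add: ennreal_minus_le_iff add.commute)
  moreover have "0 \<le> ?B" using \<alpha> by (intro integral_nonneg_AE) auto
  moreover have "(\<integral>x. (1 - \<alpha>) * g x powr \<alpha> \<partial>Q) = - ?B"
    by (simp flip: integral_minus) (simp add: algebra_simps)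
  ultimately show ?thesis by (simp add: ennreal_minus)
qed

text \<open>Only the denominator of the optimum \<open>p / q\<close> is regularised:
  \<open>p / (q + \<epsilon>)\<close> is at most \<open>1 / \<epsilon>\<close>. The integrands
  \<open>p powr \<alpha> / (q + \<epsilon>) powr (\<alpha> - 1)\<close> increase as \<epsilon>
  decreases, so monotone convergence covers an infinite Renyi integral as well.\<close>

lemma functional_approx_renyi_integral_gt_1:
  fixes P Q :: "'a::topological_space measure"
  assumes \<alpha>: "1 < \<alpha>" and P: "P \<in> borel_prob_measures" and Q: "Q \<in> borel_prob_measures"
    and r: "r < renyi_integral \<alpha> P Q"
  obtains u b where "u \<in> borel_measurable borel" "\<And>x. u x \<in> {0..b}"
    "r < ennreal ((\<integral>x. \<alpha> * u x powr (\<alpha> - 1) \<partial>P) + (\<integral>x. (1 - \<alpha>) * u x powr \<alpha> \<partial>Q))"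
proof -
  obtain \<mu> and p q :: "'a \<Rightarrow> real" where m: "finite_measure \<mu>" "sets \<mu> = sets borel"
    and p: "p \<in> borel_measurable \<mu>" "\<And>x. 0 \<le> p x" "density \<mu> p = P"
    and q: "q \<in> borel_measurable \<mu>" "\<And>x. 0 \<le> q x" "density \<mu> q = Q"
    and le1: "\<And>x. p x \<le> 1" "\<And>x. q x \<le> 1"
    using densities_le_1[OF P Q] by metis
  note [measurable] = p(1) q(1)
  have pqb: "p \<in> borel_measurable borel" "q \<in> borel_measurable borel"
    using p q m by (simp_all cong: measurable_cong_sets)
  have I: "renyi_integral \<alpha> P Q = (\<integral>\<^sup>+x. renyi_integrand \<alpha> (p x) (q x) \<partial>\<mu>)"
    using \<alpha> m p q borel_prob_measuresD[OF P] borel_prob_measuresD[OF Q]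
    by (intro renyi_integral_eq) (auto simp: finite_measure.sigma_finite_measure finite_measure_def)
  let ?e = "\<lambda>n. inverse (real (Suc n))"
  have e: "0 < ?e n" for n by auto
  let ?F = "\<lambda>n x. p x powr \<alpha> / (q x + ?e n) powr (\<alpha> - 1)"
  have "(\<lambda>n. \<integral>\<^sup>+x. ennreal (?F n x) \<partial>\<mu>) \<longlonglongrightarrow> (\<integral>\<^sup>+x. renyi_integrand \<alpha> (p x) (q x) \<partial>\<mu>)"
  proof (rule nn_integral_LIMSEQ)
    show "incseq (\<lambda>n x. ennreal (?F n x))"
    proof (intro incseq_SucI le_funI ennreal_leI)
      fix n x
      show "?F n x \<le> ?F (Suc n) x"
      proof (intro divide_left_mono powr_mono2 mult_pos_pos)
        have "?e (Suc n) \<le> ?e n" by (simp add: field_simps)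
        then show "q x + ?e (Suc n) \<le> q x + ?e n" by simp
        show "0 \<le> q x + ?e (Suc n)" "0 < (q x + ?e n) powr (\<alpha> - 1)" "0 < (q x + ?e (Suc n)) powr (\<alpha> - 1)"
          using add_nonneg_pos[OF q(2) e, of x n] add_nonneg_pos[OF q(2) e, of x "Suc n"] by auto
      qed (use \<alpha> in auto)
    qed
    show "(\<lambda>n. ennreal (?F n x)) \<longlonglongrightarrow> renyi_integrand \<alpha> (p x) (q x)" for x
    proof -
      consider "p x = 0" | "p x > 0" "q x = 0" | "q x > 0" using p(2)[of x] q(2)[of x] by linarith
      then show ?thesis
      proof cases
        case 1
        then show ?thesis using \<alpha> by (simp add: renyi_integrand_def)
      next
        case 2
        \<comment> \<open>At \<open>q x = 0 < p x\<close> the regularised integrand is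
          \<open>p x powr \<alpha> * real (Suc n) powr (\<alpha> - 1)\<close>, which diverges in
          agreement with the convention for division by zero.\<close>
        have "filterlim (\<lambda>n. real (Suc n)) at_top sequentially"
          by (rule filterlim_compose[OF filterlim_real_sequentially filterlim_Suc])
        moreover have "filterlim (\<lambda>z. z powr (\<alpha> - 1)) at_top at_top"
          using \<alpha> by (intro powr_at_top) simp
        ultimately have "filterlim (\<lambda>n. real (Suc n) powr (\<alpha> - 1)) at_top sequentially"
          by (rule filterlim_compose[rotated])
        then have "filterlim (\<lambda>n. p x powr \<alpha> * real (Suc n) powr (\<alpha> - 1)) at_top sequentially"
          by (rule filterlim_tendsto_pos_mult_at_top[OF tendsto_const, rotated]) (use 2 in simp)
        moreover have "?F n x = p x powr \<alpha> * real (Suc n) powr (\<alpha> - 1)" for n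
          using 2 powr_divide[of 1 "real (Suc n)" "\<alpha> - 1"] by (simp add: inverse_eq_divide del: of_nat_Suc)
        ultimately have "(\<lambda>n. ennreal (?F n x)) \<longlonglongrightarrow> top"
          by (simp add: ennreal_tendsto_top_eq_at_top)
        then show ?thesis using 2 \<alpha> by (simp add: renyi_integrand_def divide_ennreal_def ennreal_mult_top)
      next
        case 3
        have "(\<lambda>n. ?F n x) \<longlonglongrightarrow> p x powr \<alpha> / (q x + 0) powr (\<alpha> - 1)"
          using 3 by (intro tendsto_divide tendsto_powr tendsto_add tendsto_const LIMSEQ_inverse_real_of_nat) auto
        then show ?thesis using 3 \<alpha> by (simp add: renyi_integrand_def divide_ennreal tendsto_ennrealI)
      qed
    qed
  qed measurable
  then obtain n where n: "r < (\<integral>\<^sup>+x. ennreal (?F n x) \<partial>\<mu>)"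
    using order_tendstoD(1)[OF _ r[unfolded I]] by (force simp: eventually_sequentially)
  define \<epsilon> where "\<epsilon> = ?e n"
  have \<epsilon>: "0 < \<epsilon>" using e by (auto simp: \<epsilon>_def)
  define u where "u = (\<lambda>x. p x / (q x + \<epsilon>))"
  have u: "u \<in> borel_measurable borel" using pqb by (simp add: u_def)
  have ub: "u x \<in> {0..1 / \<epsilon>}" for x
    using p(2)[of x] q(2)[of x] le1[of x] \<epsilon> unfolding u_def atLeastAtMost_iff
    by (intro conjI frac_le divide_nonneg_pos) auto
  then have u0: "0 \<le> u x" "u x \<le> 1 / \<epsilon>" for x by auto
  have [measurable]: "u \<in> borel_measurable \<mu>" using u m by (simp cong: measurable_cong_sets)
  let ?A = "\<integral>x. \<alpha> * u x powr (\<alpha> - 1) \<partial>P" and ?B = "\<integral>x. (\<alpha> - 1) * u x powr \<alpha> \<partial>Q"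
  have B: "ennreal ?B = (\<integral>\<^sup>+x. ennreal ((\<alpha> - 1) * u x powr \<alpha> * q x) \<partial>\<mu>)"
    by (rule nn_integral_density_bounded[OF Q q, where B="(\<alpha> - 1) * (1 / \<epsilon>) powr \<alpha>", symmetric])
      (use \<alpha> u u0 in \<open>auto intro!: mult_left_mono powr_mono2\<close>)
  have "(\<integral>\<^sup>+x. ennreal (?F n x) \<partial>\<mu>) + ennreal ?B
      = (\<integral>\<^sup>+x. ennreal (?F n x) + ennreal ((\<alpha> - 1) * u x powr \<alpha> * q x) \<partial>\<mu>)"
    unfolding B by (rule nn_integral_add[symmetric]) auto
  also have "\<dots> \<le> (\<integral>\<^sup>+x. ennreal (\<alpha> * u x powr (\<alpha> - 1) * p x) \<partial>\<mu>)"
  proof (rule nn_integral_mono)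
    fix x
    define t where "t = q x + \<epsilon>"
    have t: "0 < t" "q x \<le> t" using \<epsilon> q(2)[of x] by (auto simp: t_def)
    have ux: "u x = p x / t" by (simp add: u_def t_def)
    \<comment> \<open>\<open>u x = p x / t\<close> is the equality case of Young's inequality for
      \<open>p x\<close> and \<open>t\<close>; replacing \<open>q x\<close> by the larger
      \<open>t\<close> only increases the added term.\<close>
    have 1: "u x powr (\<alpha> - 1) * p x = p x powr \<alpha> / t powr (\<alpha> - 1)"
      using t p(2)[of x] by (cases "p x = 0") (auto simp: ux powr_divide powr_diff)
    have 2: "u x powr \<alpha> * t = p x powr \<alpha> / t powr (\<alpha> - 1)"
      using t p(2)[of x] by (simp add: ux powr_divide powr_diff)
    have "?F n x + (\<alpha> - 1) * u x powr \<alpha> * q x \<le> p x powr \<alpha> / t powr (\<alpha> - 1) + (\<alpha> - 1) * (u x powr \<alpha> * t)"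
      using t \<alpha> unfolding mult.assoc by (intro add_mono mult_left_mono) (auto simp: t_def \<epsilon>_def)
    also have "\<dots> = \<alpha> * (u x powr (\<alpha> - 1) * p x)"
      unfolding 1 2 by (simp only: left_diff_distrib)
    finally show "ennreal (?F n x) + ennreal ((\<alpha> - 1) * u x powr \<alpha> * q x) \<le> ennreal (\<alpha> * u x powr (\<alpha> - 1) * p x)"
      using \<alpha> q(2)[of x] by (simp add: mult.assoc ennreal_leI flip: ennreal_plus)
  qed
  also have "\<dots> = ennreal ?A"
    by (rule nn_integral_density_bounded[OF P p, where B="\<alpha> * (1 / \<epsilon>) powr (\<alpha> - 1)"])
      (use \<alpha> u u0 in \<open>auto intro!: mult_left_mono powr_mono2\<close>)
  finally have "(\<integral>\<^sup>+x. ennreal (?F n x) \<partial>\<mu>) \<le> ennreal ?A - ennreal ?B"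
    by (simp add: ennreal_le_minus_iff add.commute)
  moreover have "0 \<le> ?B" using \<alpha> by (intro integral_nonneg_AE) auto
  moreover have "(\<integral>x. (1 - \<alpha>) * u x powr \<alpha> \<partial>Q) = - ?B"
    by (simp flip: integral_minus) (simp add: algebra_simps)
  ultimately have "r < ennreal (?A + (\<integral>x. (1 - \<alpha>) * u x powr \<alpha> \<partial>Q))"
    using n by (simp add: ennreal_minus)
  then show ?thesis using that u ub by blast
qed

section \<open>Semicontinuity\<close>

lemma bounded_continuous_comp:
  fixes g :: "'a::topological_space \<Rightarrow> real" and \<phi> :: "real \<Rightarrow> real"
  assumes g: "continuous_on UNIV g" "\<And>x. g x \<in> {a..b}" and \<phi>: "continuous_on {a..b} \<phi>"
  shows "continuous_on UNIV (\<lambda>x. \<phi> (g x))" "bounded (range (\<lambda>x. \<phi> (g x)))"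
proof -
  show "continuous_on UNIV (\<lambda>x. \<phi> (g x))"
    by (rule continuous_on_compose2[OF \<phi> g(1)]) (use g(2) in auto)
  have "bounded (\<phi> ` {a..b})"
    by (intro compact_imp_bounded compact_continuous_image \<phi> compact_Icc)
  then show "bounded (range (\<lambda>x. \<phi> (g x)))"
    by (rule bounded_subset) (use g(2) in auto)
qed

text \<open>For a fixed continuous \<open>g\<close> the functional is weakly continuous in the pair,
  so the preimage of \<open>U\<close> is open. It contains \<open>(P, Q)\<close> once
  \<open>g\<close> is far enough along a sequence whose functional values converge to that of
  \<open>u\<close>.\<close>

lemma weak_functional_neighbourhood:
  fixes P Q :: "'a::polish_space measure"
  assumes P: "P \<in> borel_prob_measures" and Q: "Q \<in> borel_prob_measures"
    and u: "u \<in> borel_measurable borel" "\<And>x. u x \<in> {a..b}"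
    and \<phi>: "continuous_on {a..b} \<phi>" and \<psi>: "continuous_on {a..b} (\<psi> :: real \<Rightarrow> real)"
    and U: "open U" "(\<integral>x. \<phi> (u x) \<partial>P) + (\<integral>x. \<psi> (u x) \<partial>Q) \<in> U"
  obtains g T where "g \<in> borel_measurable borel" "\<And>x. g x \<in> {a..b}"
    "openin (prod_topology weak_topology weak_topology) T" "(P, Q) \<in> T"
    "\<And>P' Q'. (P', Q') \<in> T \<Longrightarrow> P' \<in> borel_prob_measures \<and> Q' \<in> borel_prob_measures \<and>
      (\<integral>x. \<phi> (g x) \<partial>P') + (\<integral>x. \<psi> (g x) \<partial>Q') \<in> U"
proof -
  obtain g :: "nat \<Rightarrow> 'a \<Rightarrow> real" where g: "\<And>k. continuous_on UNIV (g k)" "\<And>k x. g k x \<in> {a..b}"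
    "(\<lambda>k. (\<integral>x. \<phi> (g k x) \<partial>P) + (\<integral>x. \<psi> (g k x) \<partial>Q)) \<longlonglongrightarrow> (\<integral>x. \<phi> (u x) \<partial>P) + (\<integral>x. \<psi> (u x) \<partial>Q)"
    using integral_approx_continuous[OF P Q u \<phi> \<psi>] by blast
  obtain k where k: "(\<integral>x. \<phi> (g k x) \<partial>P) + (\<integral>x. \<psi> (g k x) \<partial>Q) \<in> U"
    using topological_tendstoD[OF g(3) U] by (auto simp: eventually_sequentially)
  define T where "T = {z \<in> topspace (prod_topology weak_topology weak_topology).
    (\<integral>x. \<phi> (g k x) \<partial>fst z) + (\<integral>x. \<psi> (g k x) \<partial>snd z) \<in> U}"
  have "openin (prod_topology weak_topology weak_topology) T"
    unfolding T_def
    by (rule openin_continuous_map_preimage[OF continuous_map_prod_weak_integral])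
      (use bounded_continuous_comp[OF g(1,2) \<phi>] bounded_continuous_comp[OF g(1,2) \<psi>] U in simp_all)
  moreover have "g k \<in> borel_measurable borel" by (intro borel_measurable_continuous_onI g)
  moreover have "(P, Q) \<in> T" using k P Q by (simp add: T_def)
  moreover have "P' \<in> borel_prob_measures \<and> Q' \<in> borel_prob_measures \<and>
      (\<integral>x. \<phi> (g k x) \<partial>P') + (\<integral>x. \<psi> (g k x) \<partial>Q') \<in> U" if "(P', Q') \<in> T" for P' Q'
    using that by (simp add: T_def)
  ultimately show ?thesis by (intro that[OF _ g(2)[of k]])
qed

text \<open>A near-optimal functional at \<open>(P, Q)\<close>, made continuous, stays below
  \<open>r\<close> on a neighbourhood, where it bounds the Renyi integral from above.\<close>

lemma openin_renyi_integral_less: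
  assumes \<alpha>: "0 < \<alpha>" "\<alpha> < 1"
  shows "openin (prod_topology weak_topology weak_topology)
    {z \<in> topspace (prod_topology weak_topology weak_topology).
       renyi_integral \<alpha> (fst z) (snd z :: 'a::polish_space measure) < r}" (is "openin ?X ?S")
  unfolding openin_subopen[of ?X ?S]
proof
  fix z assume "z \<in> ?S"
  then obtain P Q where z: "z = (P, Q)" and P: "P \<in> borel_prob_measures" and Q: "Q \<in> borel_prob_measures"
    and r: "renyi_integral \<alpha> P Q < r" by (cases z) auto
  let ?\<phi> = "\<lambda>u::real. \<alpha> * u powr (1 - \<alpha>)" and ?\<psi> = "\<lambda>u::real. (1 - \<alpha>) * u powr (- \<alpha>)"
  obtain u a b where u: "u \<in> borel_measurable borel" "\<And>x. u x \<in> {a..b}" "0 < a"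
    "ennreal ((\<integral>x. ?\<phi> (u x) \<partial>P) + (\<integral>x. ?\<psi> (u x) \<partial>Q)) < r"
    using functional_approx_renyi_integral_lt_1[OF \<alpha> P Q r] by blast
  have "open (ennreal -` {..<r})"
    by (intro open_vimage continuous_on_ennreal continuous_on_id) auto
  moreover have "(\<integral>x. ?\<phi> (u x) \<partial>P) + (\<integral>x. ?\<psi> (u x) \<partial>Q) \<in> ennreal -` {..<r}"
    using u(4) by simp
  moreover have "continuous_on {a..b} ?\<phi>" "continuous_on {a..b} ?\<psi>"
    using u(3) by (auto intro!: continuous_intros)
  ultimately obtain g T where g: "g \<in> borel_measurable borel" "\<And>x. g x \<in> {a..b}"
    and T: "openin ?X T" "(P, Q) \<in> T"
    "\<And>P' Q'. (P', Q') \<in> T \<Longrightarrow> P' \<in> borel_prob_measures \<and> Q' \<in> borel_prob_measures \<and>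
      (\<integral>x. ?\<phi> (g x) \<partial>P') + (\<integral>x. ?\<psi> (g x) \<partial>Q') \<in> ennreal -` {..<r}"
    using weak_functional_neighbourhood[OF P Q u(1,2), where \<phi>="?\<phi>" and \<psi>="?\<psi>" and U="ennreal -` {..<r}"]
    by blast
  have "T \<subseteq> ?S"
  proof
    fix w assume w: "w \<in> T"
    obtain P' Q' where [simp]: "w = (P', Q')" by (cases w)
    have *: "P' \<in> borel_prob_measures" "Q' \<in> borel_prob_measures"
      "ennreal ((\<integral>x. ?\<phi> (g x) \<partial>P') + (\<integral>x. ?\<psi> (g x) \<partial>Q')) < r"
      using T(3)[of P' Q'] w by auto
    with renyi_integral_le_functional[OF \<alpha> *(1,2) g u(3)] show "w \<in> ?S" by auto
  qed
  with T z show "\<exists>T. openin ?X T \<and> z \<in> T \<and> T \<subseteq> ?S" by blast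
qed

text \<open>For orders above 1 the functionals bound the Renyi integral from below, so one that
  exceeds \<open>r\<close> at \<open>(P, Q)\<close> keeps the integral above \<open>r\<close>
  nearby.\<close>

lemma openin_renyi_integral_greater:
  assumes \<alpha>: "1 < \<alpha>"
  shows "openin (prod_topology weak_topology weak_topology)
    {z \<in> topspace (prod_topology weak_topology weak_topology).
       r < renyi_integral \<alpha> (fst z) (snd z :: 'a::polish_space measure)}" (is "openin ?X ?S")
  unfolding openin_subopen[of ?X ?S]
proof
  fix z assume "z \<in> ?S"
  then obtain P Q where z: "z = (P, Q)" and P: "P \<in> borel_prob_measures" and Q: "Q \<in> borel_prob_measures"
    and r: "r < renyi_integral \<alpha> P Q" by (cases z) auto
  let ?\<phi> = "\<lambda>u::real. \<alpha> * u powr (\<alpha> - 1)" and ?\<psi> = "\<lambda>u::real. (1 - \<alpha>) * u powr \<alpha>"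
  obtain u b where u: "u \<in> borel_measurable borel" "\<And>x. u x \<in> {0..b}"
    "r < ennreal ((\<integral>x. ?\<phi> (u x) \<partial>P) + (\<integral>x. ?\<psi> (u x) \<partial>Q))"
    using functional_approx_renyi_integral_gt_1[OF \<alpha> P Q r] by blast
  have "open (ennreal -` {r<..})"
    by (intro open_vimage continuous_on_ennreal continuous_on_id) auto
  moreover have "(\<integral>x. ?\<phi> (u x) \<partial>P) + (\<integral>x. ?\<psi> (u x) \<partial>Q) \<in> ennreal -` {r<..}"
    using u(3) by simp
  \<comment> \<open>The interval contains 0, where continuity of the powers rests on the positive
    exponents \<open>\<alpha> - 1\<close> and \<alpha>.\<close>
  moreover have "continuous_on {0..b} ?\<phi>" "continuous_on {0..b} ?\<psi>"
    using \<alpha> by (auto intro!: continuous_intros continuous_on_powr')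
  ultimately obtain g T where g: "g \<in> borel_measurable borel" "\<And>x. g x \<in> {0..b}"
    and T: "openin ?X T" "(P, Q) \<in> T"
    "\<And>P' Q'. (P', Q') \<in> T \<Longrightarrow> P' \<in> borel_prob_measures \<and> Q' \<in> borel_prob_measures \<and>
      (\<integral>x. ?\<phi> (g x) \<partial>P') + (\<integral>x. ?\<psi> (g x) \<partial>Q') \<in> ennreal -` {r<..}"
    using weak_functional_neighbourhood[OF P Q u(1,2), where \<phi>="?\<phi>" and \<psi>="?\<psi>" and U="ennreal -` {r<..}"]
    by blast
  have "T \<subseteq> ?S"
  proof
    fix w assume w: "w \<in> T"
    obtain P' Q' where [simp]: "w = (P', Q')" by (cases w)
    have *: "P' \<in> borel_prob_measures" "Q' \<in> borel_prob_measures"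
      "r < ennreal ((\<integral>x. ?\<phi> (g x) \<partial>P') + (\<integral>x. ?\<psi> (g x) \<partial>Q'))"
      using T(3)[of P' Q'] w by auto
    with functional_le_renyi_integral[OF \<alpha> *(1,2) g] show "w \<in> ?S" by auto
  qed
  with T z show "\<exists>T. openin ?X T \<and> z \<in> T \<and> T \<subseteq> ?S" by blast
qed

section \<open>Logarithms and superlevel sets of the divergence of finite order\<close>

lemma strict_mono_ln_ennreal: "strict_mono ln_ennreal"
proof (rule strict_monoI)
  fix x y :: ennreal assume "x < y"
  then show "ln_ennreal x < ln_ennreal y"
    by (cases x; cases y) (auto simp: ln_ennreal_def ennreal_less_iff)
qed

text \<open>Used to turn any threshold for the logarithm, infinite ones included, into a threshold
  for the integral. The right inverse is the extended exponential.\<close>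

lemma surj_ln_ennreal: "surj ln_ennreal"
proof (rule surjI)
  show "ln_ennreal (if y = \<infinity> then \<infinity> else if y = -\<infinity> then 0 else ennreal (exp (real_of_ereal y))) = y" for y
    by (cases y) (auto simp: ln_ennreal_def)
qed

text \<open>The monotone limit principle for a filter: any bound below the supremum is exceeded by
  some \<open>f a\<close>, hence eventually by \<open>f x\<close>.\<close>

lemma tendsto_SUP_eventually:
  fixes f :: "'b \<Rightarrow> ereal"
  assumes "eventually (\<lambda>x. x \<in> A) F" and "\<And>a. a \<in> A \<Longrightarrow> eventually (\<lambda>x. f a \<le> f x) F"
  shows "(f \<longlongrightarrow> (SUP a\<in>A. f a)) F"
proof (rule order_tendstoI)
  fix l assume "l < (SUP a\<in>A. f a)"
  then obtain a where "a \<in> A" "l < f a" by (auto simp: less_SUP_iff)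
  with assms(2)[OF this(1)] show "eventually (\<lambda>x. l < f x) F" by (auto elim: eventually_mono)
next
  fix l assume "(SUP a\<in>A. f a) < l"
  with assms(1) show "eventually (\<lambda>x. f x < l) F" by (auto elim!: eventually_mono intro: le_less_trans[OF SUP_upper])
qed

lemma ereal_less_mult_pos_iff:
  assumes "0 < (k::real)" shows "c < ereal k * x \<longleftrightarrow> ereal (1 / k) * c < x"
  using assms by (cases c; cases x) (auto simp: field_simps)

lemma ereal_less_mult_neg_iff:
  assumes "(k::real) < 0" shows "c < ereal k * x \<longleftrightarrow> x < ereal (1 / k) * c"
  using assms by (cases c; cases x) (auto simp: field_simps)

text \<open>The factor \<open>1 / (\<alpha> - 1)\<close> is negative for orders below 1 and positive
  above. Superlevel sets of the divergence are therefore sublevel sets of the integral in the first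
  case and superlevel sets in the second.\<close>

lemma openin_renyi_divergence_simple:
  assumes \<alpha>: "0 < \<alpha>" "\<alpha> \<noteq> 1"
  shows "openin (prod_topology weak_topology weak_topology)
    {z \<in> topspace (prod_topology weak_topology weak_topology).
       c < renyi_divergence_simple \<alpha> (fst z) (snd z :: 'a::polish_space measure)}"
proof -
  obtain r where r: "ln_ennreal r = ereal (\<alpha> - 1) * c"
    using surjD[OF surj_ln_ennreal] by metis
  show ?thesis
  proof (cases "\<alpha> < 1")
    case True
    then have "c < renyi_divergence_simple \<alpha> P Q \<longleftrightarrow> renyi_integral \<alpha> P Q < r" for P Q :: "'a measure"
      by (simp add: renyi_divergence_simple_def ereal_less_mult_neg_iff divide_less_0_iff
          strict_mono_less[OF strict_mono_ln_ennreal] flip: r)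
    with True \<alpha> openin_renyi_integral_less[of \<alpha> r] show ?thesis by simp
  next
    case False
    with \<alpha> have "1 < \<alpha>" by simp
    then have "c < renyi_divergence_simple \<alpha> P Q \<longleftrightarrow> r < renyi_integral \<alpha> P Q" for P Q :: "'a measure"
      by (simp add: renyi_divergence_simple_def ereal_less_mult_pos_iff
          strict_mono_less[OF strict_mono_ln_ennreal] flip: r)
    with \<open>1 < \<alpha>\<close> openin_renyi_integral_greater[of \<alpha> r] show ?thesis by simp
  qed
qed

section \<open>Monotonicity of the divergence in the order\<close>

lemma ereal_mult_less_left_neg_iff:
  assumes "(k::real) < 0" shows "ereal k * x < ereal k * y \<longleftrightarrow> y < x"
  using assms by (cases x; cases y) auto

text \<open>Integrating \<open>renyi_integrand_interpolate\<close> gives, for every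
  \<open>i > 0\<close>, a bound affine in the integral of order \<open>b\<close>. Taking
  \<open>i\<close> equal to that integral yields its power \<theta>.\<close>

lemma ln_renyi_integral_le:
  fixes P Q :: "'a::topological_space measure"
  assumes ab: "0 < a" "0 < b" "a < 1 \<and> b < 1 \<and> b < a \<or> 1 < a \<and> a < b"
    and P: "P \<in> borel_prob_measures" and Q: "Q \<in> borel_prob_measures"
  shows "ln_ennreal (renyi_integral a P Q) \<le> ereal ((a - 1) / (b - 1)) * ln_ennreal (renyi_integral b P Q)"
proof -
  define \<theta> where "\<theta> = (a - 1) / (b - 1)"
  have \<theta>: "0 < \<theta>" "\<theta> < 1" using ab by (auto simp: \<theta>_def field_simps)
  obtain \<mu> and p q :: "'a \<Rightarrow> real" where m: "finite_measure \<mu>" "sets \<mu> = sets borel"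
    and p: "p \<in> borel_measurable \<mu>" "\<And>x. 0 \<le> p x" "density \<mu> p = P"
    and q: "q \<in> borel_measurable \<mu>" "\<And>x. 0 \<le> q x" "density \<mu> q = Q"
    using densities_le_1[OF P Q] by metis
  note [measurable] = p(1) q(1)
  have I: "renyi_integral c P Q = (\<integral>\<^sup>+x. renyi_integrand c (p x) (q x) \<partial>\<mu>)" if "c \<in> {a, b}" for c
    using that ab m p q borel_prob_measuresD[OF P] borel_prob_measuresD[OF Q]
    by (intro renyi_integral_eq) (auto simp: finite_measure.sigma_finite_measure finite_measure_def)
  have p1: "(\<integral>\<^sup>+x. ennreal (p x) \<partial>\<mu>) = 1"
    using nn_integral_density_bounded[OF P p, of "\<lambda>_. 1" 1] borel_prob_measuresD[OF P]
    using prob_space.prob_space[of P] by simp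
  have *: "renyi_integral a P Q \<le> ennreal ((1 - \<theta>) * i powr \<theta>) + ennreal (\<theta> * i powr (\<theta> - 1)) * renyi_integral b P Q"
    if i: "0 < i" for i
  proof -
    have "renyi_integral a P Q \<le> (\<integral>\<^sup>+x. ennreal ((1 - \<theta>) * i powr \<theta>) * ennreal (p x)
        + ennreal (\<theta> * i powr (\<theta> - 1)) * renyi_integrand b (p x) (q x) \<partial>\<mu>)"
      using renyi_integrand_interpolate[OF ab p(2) q(2) i] by (simp add: I \<theta>_def nn_integral_mono)
    also have "\<dots> = ennreal ((1 - \<theta>) * i powr \<theta>) * (\<integral>\<^sup>+x. ennreal (p x) \<partial>\<mu>)
        + ennreal (\<theta> * i powr (\<theta> - 1)) * (\<integral>\<^sup>+x. renyi_integrand b (p x) (q x) \<partial>\<mu>)"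
      by (simp add: nn_integral_add nn_integral_cmult renyi_integrand_def)
    finally show ?thesis by (simp add: p1 I)
  qed
  consider "renyi_integral b P Q = top" | "renyi_integral b P Q = 0"
    | i where "0 < i" "renyi_integral b P Q = ennreal i"
    by (cases "renyi_integral b P Q") (auto simp: less_le)
  then show ?thesis
  proof cases
    case 1
    then show ?thesis using \<theta> unfolding \<theta>_def[symmetric] by (simp add: ln_ennreal_def)
  next
    case 2
    \<comment> \<open>The choice of \<open>i\<close> as the integral of order \<open>b\<close> is
      barred when that integral is 0; \<open>i = e powr (1 / \<theta>)\<close> makes the remaining
      term \<open>(1 - \<theta>) * e\<close>, which is arbitrarily small.\<close>
    have "renyi_integral a P Q \<le> 0 + ennreal e" if e: "0 < e" for e
    proof -
      have "renyi_integral a P Q \<le> ennreal ((1 - \<theta>) * e)"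
        using *[of "e powr (1 / \<theta>)"] \<theta> e by (simp add: 2 powr_powr)
      also have "\<dots> \<le> ennreal e"
        using \<theta> e by (intro ennreal_leI) (simp add: algebra_simps)
      finally show ?thesis by simp
    qed
    then have "renyi_integral a P Q \<le> 0" by (rule ennreal_le_epsilon)
    then show ?thesis by (simp add: ln_ennreal_def)
  next
    case (3 i)
    have "renyi_integral a P Q \<le> ennreal ((1 - \<theta>) * i powr \<theta> + \<theta> * i powr (\<theta> - 1) * i)"
      using *[OF 3(1)] 3 \<theta> by (simp add: ennreal_mult)
    also have "(1 - \<theta>) * i powr \<theta> + \<theta> * i powr (\<theta> - 1) * i = i powr \<theta>"
      using 3 by (simp add: powr_diff algebra_simps)
    finally have "ln_ennreal (renyi_integral a P Q) \<le> ln_ennreal (ennreal (i powr \<theta>))"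
      by (simp add: strict_mono_less_eq[OF strict_mono_ln_ennreal])
    also have "\<dots> = ereal \<theta> * ln_ennreal (renyi_integral b P Q)"
      using 3 by (simp add: ln_ennreal_def ln_powr)
    finally show ?thesis by (simp add: \<theta>_def)
  qed
qed

text \<open>The bound on logarithms is divided by the order minus 1. Below 1 it is applied with
  \<open>a\<close> and \<open>b\<close> exchanged, and the negative factor
  \<open>1 / (b - 1)\<close> reverses it.\<close>

lemma renyi_divergence_simple_mono:
  fixes P Q :: "'a::topological_space measure"
  assumes PQ: "P \<in> borel_prob_measures" "Q \<in> borel_prob_measures"
    and ab: "0 < a" "a \<le> b" "b < 1 \<or> 1 < a"
  shows "renyi_divergence_simple a P Q \<le> renyi_divergence_simple b P Q"
proof (cases "a = b")
  case False
  have "a - 1 \<noteq> 0" "b - 1 \<noteq> 0" using ab by auto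
  then have eq: "1 / (a - 1) * ((a - 1) / (b - 1)) = 1 / (b - 1)" "1 / (b - 1) * ((b - 1) / (a - 1)) = 1 / (a - 1)"
    by simp_all
  from ab(3) show ?thesis
  proof
    assume "b < 1"
    have "ereal (1 / (b - 1)) * (ereal ((b - 1) / (a - 1)) * ln_ennreal (renyi_integral a P Q))
        \<le> ereal (1 / (b - 1)) * ln_ennreal (renyi_integral b P Q)"
      using ln_renyi_integral_le[OF _ _ _ PQ, of b a] ab False \<open>b < 1\<close>
      by (simp add: not_less[symmetric] ereal_mult_less_left_neg_iff)
    then show ?thesis
      unfolding renyi_divergence_simple_def mult.assoc[symmetric] times_ereal.simps eq .
  next
    assume "1 < a"
    have "ereal (1 / (a - 1)) * ln_ennreal (renyi_integral a P Q)
        \<le> ereal (1 / (a - 1)) * (ereal ((a - 1) / (b - 1)) * ln_ennreal (renyi_integral b P Q))"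
      using ln_renyi_integral_le[OF _ _ _ PQ, of a b] ab False \<open>1 < a\<close>
      by (intro ereal_mult_left_mono) auto
    then show ?thesis
      unfolding renyi_divergence_simple_def mult.assoc[symmetric] times_ereal.simps eq .
  qed
qed simp

section \<open>The orders 1 and infinity as suprema, and the conclusion\<close>

text \<open>By monotonicity on \<open>{0<..<1}\<close> the left limit at 1 exists and is the
  supremum, so the \<open>Lim\<close> in the definition takes this value.\<close>

lemma renyi_divergence_1_eq_SUP:
  fixes P Q :: "'a::topological_space measure"
  assumes "P \<in> borel_prob_measures" "Q \<in> borel_prob_measures"
  shows "renyi_divergence 1 P Q = (SUP a\<in>{0<..<1}. renyi_divergence_simple a P Q)"
proof -
  have "((\<lambda>a. renyi_divergence_simple a P Q) \<longlongrightarrow> (SUP a\<in>{0<..<1}. renyi_divergence_simple a P Q)) (at_left 1)"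
  proof (rule tendsto_SUP_eventually)
    show "eventually (\<lambda>a. a \<in> {0<..<1}) (at_left (1::real))"
      by (auto simp: eventually_at_left_field intro: exI[of _ 0])
    show "eventually (\<lambda>b. renyi_divergence_simple a P Q \<le> renyi_divergence_simple b P Q) (at_left 1)"
      if "a \<in> {0<..<1}" for a
      using that renyi_divergence_simple_mono[OF assms, of a]
      by (auto simp: eventually_at_left_field intro!: exI[of _ a])
  qed
  then show ?thesis by (simp add: renyi_divergence_def tendsto_Lim)
qed

lemma renyi_divergence_infinity_eq_SUP:
  fixes P Q :: "'a::topological_space measure"
  assumes "P \<in> borel_prob_measures" "Q \<in> borel_prob_measures"
  shows "renyi_divergence \<infinity> P Q = (SUP a\<in>{1<..}. renyi_divergence_simple a P Q)"
proof -
  have "((\<lambda>a. renyi_divergence_simple a P Q) \<longlongrightarrow> (SUP a\<in>{1<..}. renyi_divergence_simple a P Q)) at_top"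
  proof (rule tendsto_SUP_eventually)
    show "eventually (\<lambda>a. a \<in> {1<..}) (at_top :: real filter)"
      by (simp add: eventually_gt_at_top)
    show "eventually (\<lambda>b. renyi_divergence_simple a P Q \<le> renyi_divergence_simple b P Q) at_top"
      if "a \<in> {1<..}" for a
      using that renyi_divergence_simple_mono[OF assms, of a]
      by (auto simp: eventually_at_top_linorder intro!: exI[of _ a])
  qed
  then show ?thesis by (simp add: renyi_divergence_def tendsto_Lim)
qed

text \<open>Lower semicontinuity passes to suprema because a superlevel set of a supremum is the
  union of the individual superlevel sets. This carries the result from finite orders to 1 and
  infinity.\<close>

lemma openin_less_SUP:
  fixes f :: "'i \<Rightarrow> 'a \<Rightarrow> ereal"
  assumes "\<And>i. i \<in> A \<Longrightarrow> openin X {x \<in> topspace X. c < f i x}"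
    and "\<And>x. x \<in> topspace X \<Longrightarrow> g x = (SUP i\<in>A. f i x)"
  shows "openin X {x \<in> topspace X. c < g x}"
proof -
  have "{x \<in> topspace X. c < g x} = (\<Union>i\<in>A. {x \<in> topspace X. c < f i x})"
    using assms(2) by (auto simp: less_SUP_iff)
  with assms(1) show ?thesis by auto
qed

theorem theorem19:
  fixes \<alpha> :: ereal
  assumes "0 < \<alpha>"
  shows "lower_semicontinuous_map
           (prod_topology weak_topology weak_topology :: ('a::polish_space measure \<times> 'a measure) topology)
           (\<lambda>(P, Q). renyi_divergence \<alpha> P Q)"
  unfolding lower_semicontinuous_map_def case_prod_beta
proof
  fix c :: ereal
  let ?X = "prod_topology weak_topology weak_topology :: ('a measure \<times> 'a measure) topology"
  consider "\<alpha> = 1" | "\<alpha> = \<infinity>" | a where "\<alpha> = ereal a" "0 < a" "a \<noteq> 1"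
    using assms by (cases \<alpha>) (auto simp: one_ereal_def)
  then show "openin ?X {z \<in> topspace ?X. c < renyi_divergence \<alpha> (fst z) (snd z)}"
  proof cases
    case 1
    show ?thesis unfolding 1
      by (rule openin_less_SUP[OF openin_renyi_divergence_simple renyi_divergence_1_eq_SUP]) auto
  next
    case 2
    show ?thesis unfolding 2
      by (rule openin_less_SUP[OF openin_renyi_divergence_simple renyi_divergence_infinity_eq_SUP]) auto
  next
    case (3 a)
    then show ?thesis
      using openin_renyi_divergence_simple[OF 3(2,3), of c]
      by (simp add: renyi_divergence_def one_ereal_def)
  qed
qed

end
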